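(* Let $0\le T_0<T_1\le+\infty$, let $\Gamma$ be a network with Hamiltonians $\{H_\gamma\}$ and flux limiter $x\mapsto c_x$ as described in the context. Let $u,v:\Gamma\times[T_0,T_1)\to\mathbb{R}$ be continuous functions such that $u$ is a subsolution and $v$ is a solution of (HJ$\Gamma$) in $(T_0,T_1)$, with $u(\cdot,T_0)\le v(\cdot,T_0)$. Then $u\le v$ in $\Gamma\times[T_0,T_1)$.
   Context: Network. $\Gamma=\bigcup_{\gamma\in\mathcal{E}}\gamma([0,1])\subset\mathbb{R}^N$, where $\mathcal{E}$ is a finite collection of arcs, i.e. simple $C^1$ curves $\gamma:[0,1]\to\mathbb{R}^N$ with nonvanishing derivative. Together with each arc $\gamma$ one also considers its inverse arc $-\gamma(s)=\gamma(1-s)$ (so the collection of arcs is regarded as closed under inversion). It is assumed that $\gamma((0,1))\cap\gamma'([0,1])=\emptyset$ whenever $\gamma'\ne\gamma$, $\gamma'\neq-\gamma$. Vertices are the initial and terminal points of arcs; $\mathbf{V}$ is the set of vertices. The network is connected (any two vertices are linked by a finite concatenation of arcs) and has no loops ($\gamma(0)\ne\gamma(1)$ for every arc). For $x\in\mathbf{V}$, $\Gamma_x=\{\gamma : \gamma(1)=x\}$. Hamiltonians. For each arc $\gamma$ a function $H_\gamma:[0,1]\times\mathbb{R}\to\mathbb{R}$ is given, with $H_{-\gamma}(s,p)=H_\gamma(1-s,-p)$. Each $H_\gamma$ is continuous in $(s,p)$, convex in $p$, coercive in $p$ uniformly in $s$, and for every $M>0$ there is $C_M$ with $H_\gamma(s,p)-H_\gamma(s,q)\le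 C_M|p-q|$ for all $s\in[0,1]$, $p,q\in(-M,M)$. Set $c_\gamma=-\max_{s\in[0,1]}\min_{p\in\mathbb{R}}H_\gamma(s,p)$. A flux limiter is a function $x\mapsto c_x$ from $\mathbf{V}$ to $\mathbb{R}$ with $c_x\le\min_{\gamma\in\Gamma_x}c_\gamma$ for all $x$. Equation. For $v:\Gamma\times[T_0,T_1)\to\mathbb{R}$ put $(v\circ\gamma)(s,t)=v(\gamma(s),t)$; $'$ denotes the derivative in $s$ and subscript $t$ that in $t$. (HJ$_\gamma$) is $w_t+H_\gamma(s,w')=0$ in $(0,1)\times(T_0,T_1)$. A subtangent (resp. supertangent) to a function at a point is a $C^1$ function $\varphi$ such that (function $-\varphi$) has a local minimum (resp. maximum) at that point; it is constrained to a closed set $C$ if the point is a minimizer (resp. maximizer) only relative to a neighborhood of it intersected with $C$. A continuous $v:\Gamma\times[T_0,T_1)\to\mathbb{R}$ is a supersolution of (HJ$\Gamma$) in $(T_0,T_1)$ if (i) $v\circ\gamma$ is a viscosity supersolution of (HJ$_\gamma$) for every arc $\gamma$; (ii) for every $x\in\mathbf{V}$, $t_0\in(T_0,T_1)$: if some $C^1$ subtangent $\phi$ to $v(x,\cdot)$ at $t_0$ satisfies $\frac{d}{dt}\phi(t_0)<c_x$, then there is an arc $\gamma\in\Gamma_x$ such that all $C^1$ subtangents $\varphi$, constrained to $[0,1]\times\overline{(T_0,T_1)}$, to $v\circ\gamma$ at $(1,t_0)$ satisfy $\varphi_t(1,t_0)+H_\gamma(1,\varphi'(1,t_0))\ge0$.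 It is a subsolution of (HJ$\Gamma$) in $(T_0,T_1)$ if (i) $v\circ\gamma$ is a viscosity subsolution of (HJ$_\gamma$) for every arc $\gamma$; (ii) for every $x\in\mathbf{V}$, $t_0\in(T_0,T_1)$, all $C^1$ supertangents $\psi$ to $v(x,\cdot)$ at $t_0$ satisfy $\frac{d}{dt}\psi(t_0)\le c_x$. A solution is a continuous function that is both a subsolution and a supersolution. *)

theory Defs
  imports "HOL-Analysis.Analysis"
begin

section \<open>Networks\<close>

text \<open>
  A curve on the unit interval is a function on all of the reals of which only the values on
  \<open>{0..1}\<close> matter; accordingly, derivatives are taken within \<open>{0..1}\<close>.
\<close>

definition regular_C1_curve :: "(real \<Rightarrow> 'a::real_normed_vector) \<Rightarrow> bool" where
  "regular_C1_curve \<gamma> \<longleftrightarrow>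
     (\<exists>D. continuous_on {0..1} D \<and>
          (\<forall>s\<in>{0..1}. (\<gamma> has_vector_derivative D s) (at s within {0..1}) \<and> D s \<noteq> 0))"

definition network_vertices :: "(real \<Rightarrow> 'a::topological_space) set \<Rightarrow> 'a set" where
  "network_vertices E = pathstart ` E \<union> pathfinish ` E"

definition network_points :: "(real \<Rightarrow> 'a::topological_space) set \<Rightarrow> 'a set" where
  "network_points E = (\<Union>\<gamma>\<in>E. path_image \<gamma>)"

definition arcs_into :: "(real \<Rightarrow> 'a::topological_space) set \<Rightarrow> 'a \<Rightarrow> (real \<Rightarrow> 'a) set" where
  "arcs_into E x = {\<gamma>\<in>E. pathfinish \<gamma> = x}"

text \<open>
  The inverse arc is the library's \<^const>\<open>reversepath\<close>. Two members of \<open>E\<close> that agree on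
  \<open>{0..1}\<close> are equal by the disjointness condition, so that values outside \<open>{0..1}\<close> do not
  create spurious copies of an arc. Connectedness is stated through the reflexive transitive
  closure of the relation ``some arc leads from \<open>x\<close> to \<open>y\<close>''.
\<close>

definition network :: "(real \<Rightarrow> 'a::euclidean_space) set \<Rightarrow> bool" where
  "network E \<longleftrightarrow>
     finite E \<and>
     (\<forall>\<gamma>\<in>E. simple_path \<gamma> \<and> regular_C1_curve \<gamma>) \<and>
     (\<forall>\<gamma>\<in>E. reversepath \<gamma> \<in> E) \<and>
     (\<forall>\<gamma>\<in>E. \<forall>\<gamma>'\<in>E. \<gamma>' \<noteq> \<gamma> \<and> \<gamma>' \<noteq> reversepath \<gamma> \<longrightarrow>
        \<gamma> ` {0<..<1} \<inter> \<gamma>' ` {0..1} = {}) \<and>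
     (\<forall>x\<in>network_vertices E. \<forall>y\<in>network_vertices E.
        (x, y) \<in> {(pathstart \<gamma>, pathfinish \<gamma>) | \<gamma>. \<gamma> \<in> E}\<^sup>*) \<and>
     (\<forall>\<gamma>\<in>E. pathstart \<gamma> \<noteq> pathfinish \<gamma>)"


section \<open>Hamiltonians and flux limiters\<close>

definition network_hamiltonians ::
    "(real \<Rightarrow> 'a::real_normed_vector) set \<Rightarrow> ((real \<Rightarrow> 'a) \<Rightarrow> real \<Rightarrow> real \<Rightarrow> real) \<Rightarrow> bool" where
  "network_hamiltonians E H \<longleftrightarrow>
     (\<forall>\<gamma>\<in>E. \<forall>s\<in>{0..1}. \<forall>p. H (reversepath \<gamma>) s p = H \<gamma> (1 - s) (- p)) \<and>
     (\<forall>\<gamma>\<in>E.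
        continuous_on ({0..1} \<times> UNIV) (\<lambda>(s, p). H \<gamma> s p) \<and>
        (\<forall>s\<in>{0..1}. convex_on UNIV (H \<gamma> s)) \<and>
        (\<forall>K. \<exists>R. \<forall>s\<in>{0..1}. \<forall>p. R \<le> \<bar>p\<bar> \<longrightarrow> K \<le> H \<gamma> s p) \<and>
        (\<forall>M>0. \<exists>C. \<forall>s\<in>{0..1}. \<forall>p\<in>{-M<..<M}. \<forall>q\<in>{-M<..<M}.
           H \<gamma> s p - H \<gamma> s q \<le> C * \<bar>p - q\<bar>))"

text \<open>
  The constant \<open>- max\<^sub>s min\<^sub>p H(s,p)\<close> of an arc. For a Hamiltonian that is continuous and coercive
  in \<open>p\<close> uniformly in \<open>s\<close>, the infimum and the supremum below are attained.
\<close>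

definition arc_constant :: "(real \<Rightarrow> real \<Rightarrow> real) \<Rightarrow> real" where
  "arc_constant h = - (SUP s\<in>{0..1}. INF p. h s p)"

definition flux_limiter ::
    "(real \<Rightarrow> 'a::topological_space) set \<Rightarrow> ((real \<Rightarrow> 'a) \<Rightarrow> real \<Rightarrow> real \<Rightarrow> real) \<Rightarrow> ('a \<Rightarrow> real) \<Rightarrow> bool" where
  "flux_limiter E H c \<longleftrightarrow>
     (\<forall>x\<in>network_vertices E. c x \<le> Min ((\<lambda>\<gamma>. arc_constant (H \<gamma>)) ` arcs_into E x))"


section \<open>Test functions\<close>

definition C1_near :: "'b::real_normed_vector \<Rightarrow> ('b \<Rightarrow> real) \<Rightarrow> bool" where
  "C1_near z \<phi> \<longleftrightarrow>
     (\<exists>U D. open U \<and> z \<in> U \<and>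
        (\<forall>y\<in>U. (\<phi> has_derivative blinfun_apply (D y)) (at y)) \<and> continuous_on U D)"

definition constrained_subtangent ::
    "'b::real_normed_vector set \<Rightarrow> ('b \<Rightarrow> real) \<Rightarrow> 'b \<Rightarrow> ('b \<Rightarrow> real) \<Rightarrow> bool" where
  "constrained_subtangent C f z \<phi> \<longleftrightarrow>
     C1_near z \<phi> \<and> (\<forall>\<^sub>F y in at z within C. f z - \<phi> z \<le> f y - \<phi> y)"

definition subtangent ::
    "('b::real_normed_vector \<Rightarrow> real) \<Rightarrow> 'b \<Rightarrow> ('b \<Rightarrow> real) \<Rightarrow> bool" where
  "subtangent f z \<phi> \<longleftrightarrow> C1_near z \<phi> \<and> (\<forall>\<^sub>F y in at z. f z - \<phi> z \<le> f y - \<phi> y)"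

definition supertangent ::
    "('b::real_normed_vector \<Rightarrow> real) \<Rightarrow> 'b \<Rightarrow> ('b \<Rightarrow> real) \<Rightarrow> bool" where
  "supertangent f z \<phi> \<longleftrightarrow> C1_near z \<phi> \<and> (\<forall>\<^sub>F y in at z. f y - \<phi> y \<le> f z - \<phi> z)"

abbreviation deriv_s :: "(real \<times> real \<Rightarrow> real) \<Rightarrow> real \<Rightarrow> real \<Rightarrow> real" where
  "deriv_s \<phi> s t \<equiv> deriv (\<lambda>\<sigma>. \<phi> (\<sigma>, t)) s"

abbreviation deriv_t :: "(real \<times> real \<Rightarrow> real) \<Rightarrow> real \<Rightarrow> real \<Rightarrow> real" where
  "deriv_t \<phi> s t \<equiv> deriv (\<lambda>\<tau>. \<phi> (s, \<tau>)) t"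


section \<open>Sub- and supersolutions\<close>

text \<open>The final time may be infinite.\<close>

definition time_open :: "real \<Rightarrow> ereal \<Rightarrow> real set" where
  "time_open T0 T1 = {t. T0 < t \<and> ereal t < T1}"

definition time_halfopen :: "real \<Rightarrow> ereal \<Rightarrow> real set" where
  "time_halfopen T0 T1 = {t. T0 \<le> t \<and> ereal t < T1}"

definition along :: "('a \<times> real \<Rightarrow> real) \<Rightarrow> (real \<Rightarrow> 'a) \<Rightarrow> real \<times> real \<Rightarrow> real" where
  "along v \<gamma> = (\<lambda>(s, t). v (\<gamma> s, t))"

text \<open>
  Viscosity sub- and supersolutions of \<open>w\<^sub>t + h(s, w') = 0\<close> in \<open>(0,1) \<times> (T0,T1)\<close>.
\<close>

definition viscosity_supersolution ::
    "(real \<Rightarrow> real \<Rightarrow> real) \<Rightarrow> real \<Rightarrow> ereal \<Rightarrow> (real \<times> real \<Rightarrow> real) \<Rightarrow> bool" where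
  "viscosity_supersolution h T0 T1 w \<longleftrightarrow>
     (\<forall>s\<in>{0<..<1}. \<forall>t\<in>time_open T0 T1. \<forall>\<phi>. subtangent w (s, t) \<phi> \<longrightarrow>
        deriv_t \<phi> s t + h s (deriv_s \<phi> s t) \<ge> 0)"

definition viscosity_subsolution ::
    "(real \<Rightarrow> real \<Rightarrow> real) \<Rightarrow> real \<Rightarrow> ereal \<Rightarrow> (real \<times> real \<Rightarrow> real) \<Rightarrow> bool" where
  "viscosity_subsolution h T0 T1 w \<longleftrightarrow>
     (\<forall>s\<in>{0<..<1}. \<forall>t\<in>time_open T0 T1. \<forall>\<phi>. supertangent w (s, t) \<phi> \<longrightarrow>
        deriv_t \<phi> s t + h s (deriv_s \<phi> s t) \<le> 0)"

definition HJ_supersolution ::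
    "(real \<Rightarrow> 'a::euclidean_space) set \<Rightarrow> ((real \<Rightarrow> 'a) \<Rightarrow> real \<Rightarrow> real \<Rightarrow> real) \<Rightarrow> ('a \<Rightarrow> real) \<Rightarrow>
     real \<Rightarrow> ereal \<Rightarrow> ('a \<times> real \<Rightarrow> real) \<Rightarrow> bool" where
  "HJ_supersolution E H c T0 T1 v \<longleftrightarrow>
     continuous_on (network_points E \<times> time_halfopen T0 T1) v \<and>
     (\<forall>\<gamma>\<in>E. viscosity_supersolution (H \<gamma>) T0 T1 (along v \<gamma>)) \<and>
     (\<forall>x\<in>network_vertices E. \<forall>t0\<in>time_open T0 T1.
        (\<exists>\<phi>. subtangent (\<lambda>t. v (x, t)) t0 \<phi> \<and> deriv \<phi> t0 < c x) \<longrightarrow>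
        (\<exists>\<gamma>\<in>arcs_into E x. \<forall>\<phi>.
           constrained_subtangent ({0..1} \<times> closure (time_open T0 T1)) (along v \<gamma>) (1, t0) \<phi> \<longrightarrow>
             deriv_t \<phi> 1 t0 + H \<gamma> 1 (deriv_s \<phi> 1 t0) \<ge> 0))"

definition HJ_subsolution ::
    "(real \<Rightarrow> 'a::euclidean_space) set \<Rightarrow> ((real \<Rightarrow> 'a) \<Rightarrow> real \<Rightarrow> real \<Rightarrow> real) \<Rightarrow> ('a \<Rightarrow> real) \<Rightarrow>
     real \<Rightarrow> ereal \<Rightarrow> ('a \<times> real \<Rightarrow> real) \<Rightarrow> bool" where
  "HJ_subsolution E H c T0 T1 u \<longleftrightarrow>
     continuous_on (network_points E \<times> time_halfopen T0 T1) u \<and>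
     (\<forall>\<gamma>\<in>E. viscosity_subsolution (H \<gamma>) T0 T1 (along u \<gamma>)) \<and>
     (\<forall>x\<in>network_vertices E. \<forall>t0\<in>time_open T0 T1. \<forall>\<psi>.
        supertangent (\<lambda>t. u (x, t)) t0 \<psi> \<longrightarrow> deriv \<psi> t0 \<le> c x)"

definition HJ_solution ::
    "(real \<Rightarrow> 'a::euclidean_space) set \<Rightarrow> ((real \<Rightarrow> 'a) \<Rightarrow> real \<Rightarrow> real \<Rightarrow> real) \<Rightarrow> ('a \<Rightarrow> real) \<Rightarrow>
     real \<Rightarrow> ereal \<Rightarrow> ('a \<times> real \<Rightarrow> real) \<Rightarrow> bool" where
  "HJ_solution E H c T0 T1 v \<longleftrightarrow>
     HJ_subsolution E H c T0 T1 v \<and> HJ_supersolution E H c T0 T1 v"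

end

theory Submission
  imports Defs
begin

text \<open>
  Subtracting from \<open>u\<close> a steep increasing function of time gives a strict subsolution that lies
  below \<open>v\<close> at both ends of a compact time interval. Regularize it by sup-convolution in time and
  \<open>v\<close> by inf-convolution in time: both remain sub- and supersolutions, the first becomes semiconvex
  and, by coercivity, Lipschitz in space, the second semiconcave. At a maximum of the difference
  both are differentiable in time.

  A maximum inside an arc is excluded by doubling the space variable. At a maximum \<open>(x, t\<^sub>0)\<close>
  over a vertex, the time slope is a superdifferential of the subsolution at \<open>x\<close>, hence lies strictly
  below \<open>c x\<close>, and the vertex condition supplies an arc along which every constrained subtangent
  of the supersolution at \<open>(x, t\<^sub>0)\<close> is a supersolution test. On this arc the critical space slope of the
  subsolution is admissible both as a slope of such a subtangent and, in the limit, as a slope of the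
  subsolution at nearby interior points. The two inequalities contradict each other.

  Only quadratic test functions are needed.
\<close>

text \<open>The vertex is the obstacle. There the subsolution is tested in time only, so no
  inequality involving a Hamiltonian is available at the end of an arc; it has to be imported from
  interior points, and this works only if the time slopes near the end are close to the one at the
  vertex. Convolution in time alone provides this control: it commutes with restriction to an arc,
  does not disturb the branching, and keeps the inequalities unchanged because the Hamiltonians do
  not depend on time. A maximum of the difference forces one time slope \<open>q\<close> on both
  functions, which therefore cancels between the two inequalities. Space variables are not doubled
  at a vertex. The maximum itself says that the regularized subsolution, up to a constant, supports
  the regularized supersolution from below, so its subjets can be fed into the condition on the
  chosen arc. The convolutions read the original functions at displaced times. This is why the
  strict order at both ends of the time interval is needed: it keeps the maximum and the displaced
  times away from those ends.\<close>

section \<open>Superjets\<close>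

text \<open>The error is quadratic rather than little-o, so the right-hand side is itself a smooth
  test function. Subjets of \<open>w\<close> with slope \<open>g\<close> are expressed as superjets
  of \<open>- w\<close> with slope \<open>- g\<close>, and the set \<open>S\<close> allows for
  contact that is constrained to an arc closed at its end.\<close>

definition superjet :: "'b::real_inner set \<Rightarrow> ('b \<Rightarrow> real) \<Rightarrow> 'b \<Rightarrow> 'b \<Rightarrow> bool" where
  "superjet S w z g \<longleftrightarrow>
     (\<exists>C r. r > 0 \<and> (\<forall>y\<in>S. dist y z < r \<longrightarrow> w y \<le> w z + g \<bullet> (y - z) + C * (norm (y - z))\<^sup>2))"

lemma superjetI:
  assumes "r > 0"
    and "\<And>y. y \<in> S \<Longrightarrow> dist y z < r \<Longrightarrow> w y \<le> w z + g \<bullet> (y - z) + C * (norm (y - z))\<^sup>2"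
  shows "superjet S w z g"
  using assms unfolding superjet_def by blast

section \<open>Superjets in space-time coordinates\<close>

lemma norm_Pair_power2: "(norm (x, y))\<^sup>2 = (norm x)\<^sup>2 + (norm y)\<^sup>2"
  by (simp add: norm_Pair)

lemma superjet_pairI:
  fixes w :: "real \<times> real \<Rightarrow> real"
  assumes "r > 0"
    and "\<And>s t. (s, t) \<in> S \<Longrightarrow> \<bar>s - s0\<bar> < r \<Longrightarrow> \<bar>t - t0\<bar> < r \<Longrightarrow>
      w (s, t) \<le> w (s0, t0) + p * (s - s0) + q * (t - t0) + C * ((s - s0)\<^sup>2 + (t - t0)\<^sup>2)"
  shows "superjet S w (s0, t0) (p, q)"
proof (rule superjetI[OF assms(1), where C = C])
  fix y assume y: "y \<in> S" "dist y (s0, t0) < r"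
  obtain s t where [simp]: "y = (s, t)" by (cases y)
  have "\<bar>s - s0\<bar> < r" "\<bar>t - t0\<bar> < r"
    using dist_fst_le[of y "(s0, t0)"] dist_snd_le[of y "(s0, t0)"] y(2)
    by (auto simp: dist_real_def)
  then show "w y \<le> w (s0, t0) + (p, q) \<bullet> (y - (s0, t0)) + C * (norm (y - (s0, t0)))\<^sup>2"
    using assms(2)[of s t] y(1) by (simp add: norm_Pair_power2 algebra_simps)
qed

lemma superjet_pairD:
  fixes w :: "real \<times> real \<Rightarrow> real"
  assumes "superjet S w (s0, t0) (p, q)"
  obtains C r where "r > 0" and "C \<ge> 0"
    and "\<And>s t. (s, t) \<in> S \<Longrightarrow> \<bar>s - s0\<bar> < r \<Longrightarrow> \<bar>t - t0\<bar> < r \<Longrightarrow>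
      w (s, t) \<le> w (s0, t0) + p * (s - s0) + q * (t - t0) + C * ((s - s0)\<^sup>2 + (t - t0)\<^sup>2)"
proof -
  obtain C r where r: "r > 0" and *: "\<And>y. y \<in> S \<Longrightarrow> dist y (s0, t0) < r \<Longrightarrow>
      w y \<le> w (s0, t0) + (p, q) \<bullet> (y - (s0, t0)) + C * (norm (y - (s0, t0)))\<^sup>2"
    using assms unfolding superjet_def by blast
  show ?thesis
  proof (rule that[of "r / 2" "\<bar>C\<bar>"])
    fix s t assume st: "(s, t) \<in> S" "\<bar>s - s0\<bar> < r / 2" "\<bar>t - t0\<bar> < r / 2"
    have "dist (s, t) (s0, t0) \<le> \<bar>s - s0\<bar> + \<bar>t - t0\<bar>"
      using norm_Pair_le[of "s - s0" "t - t0"] by (simp add: dist_norm)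
    with st have "dist (s, t) (s0, t0) < r" by linarith
    from *[OF st(1) this]
    have "w (s, t) \<le> w (s0, t0) + p * (s - s0) + q * (t - t0) + C * ((s - s0)\<^sup>2 + (t - t0)\<^sup>2)"
      by (simp add: norm_Pair_power2)
    moreover have "C * ((s - s0)\<^sup>2 + (t - t0)\<^sup>2) \<le> \<bar>C\<bar> * ((s - s0)\<^sup>2 + (t - t0)\<^sup>2)"
      by (intro mult_right_mono) auto
    ultimately show "w (s, t) \<le> w (s0, t0) + p * (s - s0) + q * (t - t0) + \<bar>C\<bar> * ((s - s0)\<^sup>2 + (t - t0)\<^sup>2)"
      by linarith
  qed (use r in auto)
qed

lemma superjet_boxI:
  fixes w :: "real \<times> real \<Rightarrow> real"
  assumes "s0 \<in> {l<..<m}" and "t0 \<in> {l'<..<m'}"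
    and "\<And>s t. s \<in> {l..m} \<Longrightarrow> t \<in> {l'..m'} \<Longrightarrow>
      w (s, t) \<le> w (s0, t0) + p * (s - s0) + q * (t - t0) + C * ((s - s0)\<^sup>2 + (t - t0)\<^sup>2)"
  shows "superjet UNIV w (s0, t0) (p, q)"
proof (rule superjet_pairI[where C = C])
  show "Min {s0 - l, m - s0, t0 - l', m' - t0} > 0" using assms by auto
qed (use assms in \<open>auto simp: abs_less_iff\<close>)

text \<open>A small \<open>\<tau>\<close> with the sign of \<open>a\<close> would make the linear
  side dominate the quadratic one. The constant may have any sign, so curvature errors can simply be
  added up before the lemma is applied.\<close>

lemma slope_eq_0:
  fixes a C r :: real
  assumes "r > 0" and "\<And>\<tau>. \<bar>\<tau>\<bar> < r \<Longrightarrow> a * \<tau> \<le> C * \<tau>\<^sup>2"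
  shows "a = 0"
proof (rule ccontr)
  assume "a \<noteq> 0"
  define e where "e = min (r / 2) (\<bar>a\<bar> / (2 * (\<bar>C\<bar> + 1)))"
  have e: "e > 0" "e < r" using assms(1) \<open>a \<noteq> 0\<close> by (auto simp: e_def)
  have "e \<le> \<bar>a\<bar> / (2 * (\<bar>C\<bar> + 1))" by (simp add: e_def)
  then have "e * (2 * (\<bar>C\<bar> + 1)) \<le> \<bar>a\<bar>" by (simp add: pos_le_divide_eq)
  then have 1: "e * (\<bar>C\<bar> + 1) < \<bar>a\<bar>" using \<open>a \<noteq> 0\<close> by (simp add: algebra_simps)
  have "a * (sgn a * e) \<le> C * (sgn a * e)\<^sup>2"
    using e by (intro assms(2)) (auto simp: abs_mult abs_sgn_eq)
  then have "\<bar>a\<bar> * e \<le> C * e\<^sup>2"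
    using \<open>a \<noteq> 0\<close> by (auto simp: sgn_if power2_eq_square split: if_splits)
  then have "\<bar>a\<bar> \<le> C * e" using e(1) by (simp add: power2_eq_square)
  also have "\<dots> \<le> \<bar>C\<bar> * e" using e by (intro mult_right_mono) auto
  finally show False using 1 e(1) by (simp add: algebra_simps)
qed

text \<open>A paraboloid from above and a parabola in time from below touch at the same point, so
  their time slopes agree. Semiconvexity supplies the lower parabola, and with it the time slope of
  every superjet.\<close>

lemma superjet_time_slope:
  fixes w :: "real \<times> real \<Rightarrow> real"
  assumes "superjet UNIV w (s, t) (p, q)" and "r > 0"
    and "\<And>t'. \<bar>t' - t\<bar> < r \<Longrightarrow> w (s, t) + q' * (t' - t) - c * (t' - t)\<^sup>2 \<le> w (s, t')"
  shows "q = q'"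
proof -
  obtain C d where d: "d > 0" and *: "\<And>s' t'. (s', t') \<in> UNIV \<Longrightarrow> \<bar>s' - s\<bar> < d \<Longrightarrow> \<bar>t' - t\<bar> < d \<Longrightarrow>
      w (s', t') \<le> w (s, t) + p * (s' - s) + q * (t' - t) + C * ((s' - s)\<^sup>2 + (t' - t)\<^sup>2)"
    using superjet_pairD[OF assms(1)] by metis
  have "q' - q = 0"
  proof (rule slope_eq_0)
    show "min d r > 0" using d assms(2) by simp
    fix \<tau> :: real assume "\<bar>\<tau>\<bar> < min d r"
    then show "(q' - q) * \<tau> \<le> (C + c) * \<tau>\<^sup>2"
      using *[of s "t + \<tau>"] assms(3)[of "t + \<tau>"] d by (simp add: algebra_simps)
  qed
  then show ?thesis by simp
qed

section \<open>From slopes of superjets to increments along an arc\<close>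

lemma bounded_on_compact:
  fixes w :: "'b::metric_space \<Rightarrow> real"
  assumes "compact K" and "continuous_on K w"
  obtains M where "\<And>z. z \<in> K \<Longrightarrow> \<bar>w z\<bar> \<le> M"
  using compact_imp_bounded[OF compact_continuous_image[OF assms(2,1)]] that
  unfolding bounded_iff by auto

text \<open>The one-sided square has a Lipschitz derivative, so it expands with a quadratic error
  and may be part of a test function. It serves wherever a penalty must switch on only beyond a
  threshold.\<close>

lemma max_0_square_le:
  fixes x y :: real
  shows "(max 0 y)\<^sup>2 \<le> (max 0 x)\<^sup>2 + 2 * max 0 x * (y - x) + (y - x)\<^sup>2"
proof (cases "x \<le> 0")
  case True
  then show ?thesis by (auto simp: max_def not_le power2_eq_square intro!: mult_mono)
next
  case False
  then have "(max 0 x)\<^sup>2 + 2 * max 0 x * (y - x) + (y - x)\<^sup>2 = y\<^sup>2"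
    by (simp add: max_def power2_eq_square algebra_simps)
  then show ?thesis by (simp add: max_def)
qed

text \<open>
  The quadratic term \<open>A\<close>, active only to the right of \<open>m\<close>, keeps the maximum away from \<open>s\<^sub>2\<close>
  without ever lowering the slope of the test function below \<open>R\<close>.
\<close>

lemma increment_le_of_superjet_slopes:
  fixes w :: "real \<times> real \<Rightarrow> real"
  assumes cont: "continuous_on ({0..1} \<times> {l..u}) w" and t1: "t1 \<in> {l<..<u}"
    and slope: "\<And>s t p q. s \<in> {0<..<1} \<Longrightarrow> t \<in> {l<..<u} \<Longrightarrow> superjet UNIV w (s, t) (p, q) \<Longrightarrow> p < R"
    and R: "R \<ge> 0" and s12: "0 \<le> s1" "s1 \<le> s2" "s2 \<le> 1"
  shows "w (s2, t1) \<le> w (s1, t1) + R * (s2 - s1)"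
proof (rule ccontr)
  assume "\<not> ?thesis"
  then have gt: "w (s2, t1) > w (s1, t1) + R * (s2 - s1)" by simp
  then have "s1 \<noteq> s2" by auto
  with s12 have "s1 < s2" by simp
  have cont_s: "continuous_on {0..1} (\<lambda>s. w (s, t1))"
    by (rule continuous_on_compose2[OF cont]) (use t1 in \<open>auto intro!: continuous_intros\<close>)
  have cont_t: "continuous_on {l..u} (\<lambda>t. w (s1, t))"
    by (rule continuous_on_compose2[OF cont]) (use s12 in \<open>auto intro!: continuous_intros\<close>)
  \<comment> \<open>By continuity the excess over slope \<open>R\<close> is already present slightly
    before \<open>s2\<close>; this leaves the interval from \<open>m\<close> to \<open>s2\<close>
    for the one-sided penalty.\<close>
  obtain m where m: "s1 < m" "m < s2" and m_gt: "w (m, t1) > w (s1, t1) + R * (m - s1)"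
  proof -
    have c: "continuous_on {0..1} (\<lambda>s. w (s, t1) - (w (s1, t1) + R * (s - s1)))"
      by (intro continuous_intros cont_s)
    have pos: "0 < w (s2, t1) - (w (s1, t1) + R * (s2 - s1))" using gt by simp
    obtain d where d: "d > 0" and *: "\<forall>s\<in>{0..1}. dist s s2 < d \<longrightarrow>
        dist (w (s, t1) - (w (s1, t1) + R * (s - s1))) (w (s2, t1) - (w (s1, t1) + R * (s2 - s1)))
          < w (s2, t1) - (w (s1, t1) + R * (s2 - s1))"
      using c[unfolded continuous_on_iff, rule_format, of s2, OF _ pos] s12 by auto
    define m where "m = max ((s1 + s2) / 2) (s2 - d / 2)"
    have "s1 < m" "m < s2" "dist m s2 < d" using \<open>s1 < s2\<close> d by (auto simp: m_def dist_real_def less_max_iff_disj)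
    with *[rule_format, of m] s12 that show thesis by (auto simp: dist_real_def)
  qed
  define g where "g = w (m, t1) - (w (s1, t1) + R * (m - s1))"
  have g: "g > 0" using m_gt by (simp add: g_def)
  obtain d where d: "d > 0" and d_g: "\<And>t. t \<in> {l..u} \<Longrightarrow> \<bar>t - t1\<bar> < d \<Longrightarrow> w (s1, t) < w (s1, t1) + g"
  proof -
    have "t1 \<in> {l..u}" using t1 by auto
    then obtain d where "d > 0" and "\<forall>t\<in>{l..u}. dist t t1 < d \<longrightarrow> dist (w (s1, t)) (w (s1, t1)) < g"
      using cont_t[unfolded continuous_on_iff] g by blast
    then show thesis by (intro that[of d]) (force simp: dist_real_def)+
  qed
  define r where "r = Min {d / 2, t1 - l, u - t1}"
  have r: "r > 0" "r < d" "r \<le> t1 - l" "r \<le> u - t1" using d t1 by (auto simp: r_def)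
  have "compact ({0..1 :: real} \<times> {l..u})" by (intro compact_Times compact_Icc)
  then obtain M where M: "\<And>z. z \<in> {0..1} \<times> {l..u} \<Longrightarrow> \<bar>w z\<bar> \<le> M"
    using bounded_on_compact[OF _ cont] by blast
  have "0 \<le> M" using M[of "(s1, t1)"] s12 t1 by auto
  \<comment> \<open>\<open>2 * M\<close> bounds the oscillation of \<open>w\<close>. With this
    normalization the penalty reaches \<open>2 * M\<close> on the right edge and on both time edges
    of the box, while the left edge is excluded by the choice of \<open>d\<close>.\<close>
  define A where "A = 2 * M / (s2 - m)\<^sup>2"
  define B where "B = 2 * M / r\<^sup>2"
  have A: "A * (s2 - m)\<^sup>2 = 2 * M" "A \<ge> 0" using m \<open>0 \<le> M\<close> by (auto simp: A_def)
  have B: "B * r\<^sup>2 = 2 * M" "B \<ge> 0" using r \<open>0 \<le> M\<close> by (auto simp: B_def)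
  define P where "P s t = R * (s - s1) + A * (max 0 (s - m))\<^sup>2 + B * (t - t1)\<^sup>2" for s t
  have P_nonneg: "P s t \<ge> A * (max 0 (s - m))\<^sup>2 + B * (t - t1)\<^sup>2" if "s \<ge> s1" for s t
    using R that by (simp add: P_def)
  let ?K = "{s1..s2} \<times> {t1 - r..t1 + r}"
  have sub: "?K \<subseteq> {0..1} \<times> {l..u}" using r s12 by auto
  have "continuous_on ?K (\<lambda>z. w z - P (fst z) (snd z))"
    unfolding P_def by (intro continuous_intros continuous_on_subset[OF cont sub])
  moreover have "compact ?K" by (intro compact_Times compact_Icc)
  moreover have "?K \<noteq> {}" using r s12 by auto
  ultimately obtain z where z: "z \<in> ?K" and z_max: "\<And>y. y \<in> ?K \<Longrightarrow> w y - P (fst y) (snd y) \<le> w z - P (fst z) (snd z)"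
    using continuous_attains_sup[of ?K "\<lambda>z. w z - P (fst z) (snd z)"] by blast
  obtain s t where z_eq: "z = (s, t)" by (cases z)
  have st: "s1 \<le> s" "s \<le> s2" "t1 - r \<le> t" "t \<le> t1 + r" using z z_eq by auto
  have "w (m, t1) - P m t1 \<le> w (s, t) - P s t"
    using z_max[of "(m, t1)"] m r z_eq by auto
  then have low: "w (s1, t1) + g \<le> w (s, t) - P s t" by (simp add: g_def P_def)
  have M1: "- M \<le> w (s1, t1)" "w (s, t) \<le> M"
    using M[of "(s1, t1)"] M[of "(s, t)"] subsetD[OF sub z] z_eq s12 t1 by (auto simp: abs_le_iff)
  have "s \<noteq> s1"
  proof
    assume "s = s1"
    moreover have "w (s1, t) < w (s1, t1) + g" using d_g[of t] st r by auto
    moreover have "P s t \<ge> 0" using P_nonneg[of s t] A B st by (smt (verit) mult_nonneg_nonneg zero_le_power2)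
    ultimately show False using low by simp
  qed
  moreover have "s \<noteq> s2"
  proof
    assume "s = s2"
    then have "P s t \<ge> 2 * M" using P_nonneg[of s t] A B st m
      by (smt (verit) mult_nonneg_nonneg zero_le_power2)
    then show False using low M1 g by simp
  qed
  moreover have "\<bar>t - t1\<bar> \<noteq> r"
  proof
    assume "\<bar>t - t1\<bar> = r"
    then have "(t - t1)\<^sup>2 = r\<^sup>2" by (metis power2_abs)
    then have "P s t \<ge> 2 * M" using P_nonneg[of s t] A B st m
      by (smt (verit) mult_nonneg_nonneg zero_le_power2)
    then show False using low M1 g by simp
  qed
  ultimately have inner: "s \<in> {s1<..<s2}" "t \<in> {t1 - r<..<t1 + r}" using st by auto
  have "superjet UNIV w (s, t) (R + 2 * A * max 0 (s - m), 2 * B * (t - t1))"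
  proof (rule superjet_boxI[OF inner, where C = "A + B"])
    fix s' t' assume st': "s' \<in> {s1..s2}" "t' \<in> {t1 - r..t1 + r}"
    have "w (s', t') \<le> w (s, t) + (P s' t' - P s t)"
      using z_max[of "(s', t')"] st' z_eq by auto
    moreover have "A * (max 0 (s' - m))\<^sup>2 \<le> A * ((max 0 (s - m))\<^sup>2 + 2 * max 0 (s - m) * (s' - s) + (s' - s)\<^sup>2)"
      using max_0_square_le[of "s' - m" "s - m"] A by (intro mult_left_mono) auto
    moreover have "0 \<le> A * (t' - t)\<^sup>2" "0 \<le> B * (s' - s)\<^sup>2" using A B by auto
    ultimately show "w (s', t') \<le> w (s, t) + (R + 2 * A * max 0 (s - m)) * (s' - s)
        + 2 * B * (t - t1) * (t' - t) + (A + B) * ((s' - s)\<^sup>2 + (t' - t)\<^sup>2)"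
      by (simp add: P_def power2_eq_square algebra_simps)
  qed
  moreover have "s \<in> {0<..<1}" "t \<in> {l<..<u}" using inner s12 r by auto
  ultimately have "R + 2 * A * max 0 (s - m) < R" using slope by blast
  moreover have "0 \<le> 2 * A * max 0 (s - m)" using A by simp
  ultimately show False by linarith
qed

text \<open>Among the points at distance at least \<open>e\<close> from \<open>z0\<close> with
  \<open>F\<close> not below \<open>F z0\<close>, strictness on the zero set of \<open>G\<close>
  makes \<open>G\<close> positive, and compactness bounds it away from zero. A large multiple of
  \<open>G\<close> then rules all of them out. In the doubling argument \<open>G\<close> is the
  squared distance of the two space variables.\<close>

lemma penalized_argmax_near:
  fixes F G :: "'b::metric_space \<Rightarrow> real"
  assumes K: "compact K" and F: "continuous_on K F" and G: "continuous_on K G"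
    and G_nonneg: "\<And>z. z \<in> K \<Longrightarrow> 0 \<le> G z"
    and strict: "\<And>z. z \<in> K \<Longrightarrow> G z = 0 \<Longrightarrow> z \<noteq> z0 \<Longrightarrow> F z < F z0"
    and e: "e > 0"
  obtains N :: real where "N > 0" and "\<And>z. z \<in> K \<Longrightarrow> F z0 \<le> F z - N * G z \<Longrightarrow> dist z z0 < e"
proof -
  define K' where "K' = {z \<in> K. e \<le> dist z z0 \<and> F z0 \<le> F z}"
  have "closedin (top_of_set K) {z \<in> K. e \<le> dist z z0}" "closedin (top_of_set K) {z \<in> K. F z0 \<le> F z}"
    using continuous_closedin_preimage[of K "\<lambda>z. dist z z0" "{e..}"] continuous_closedin_preimage[OF F, of "{F z0..}"]
      continuous_on_dist[OF continuous_on_id continuous_on_const, of K z0]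
    by (auto simp: vimage_def Int_def)
  then have "closedin (top_of_set K) ({z \<in> K. e \<le> dist z z0} \<inter> {z \<in> K. F z0 \<le> F z})" by (rule closedin_Int)
  moreover have "{z \<in> K. e \<le> dist z z0} \<inter> {z \<in> K. F z0 \<le> F z} = K'" by (auto simp: K'_def)
  ultimately have K': "compact K'" using closedin_compact[OF K] by simp
  have K'_sub: "K' \<subseteq> K" by (auto simp: K'_def)
  show thesis
  proof (cases "K' = {}")
    case True
    show thesis
    proof (rule that[of 1])
      fix z assume z: "z \<in> K" "F z0 \<le> F z - 1 * G z"
      then have "F z0 \<le> F z" using G_nonneg[of z] by linarith
      then show "dist z z0 < e" using z True by (force simp: K'_def not_le)
    qed simp
  next
    case False
    obtain zg where zg: "zg \<in> K'" "\<And>z. z \<in> K' \<Longrightarrow> G zg \<le> G z"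
      using continuous_attains_inf[OF K' False continuous_on_subset[OF G K'_sub]] by blast
    obtain zf where zf: "zf \<in> K'" "\<And>z. z \<in> K' \<Longrightarrow> F z \<le> F zf"
      using continuous_attains_sup[OF K' False continuous_on_subset[OF F K'_sub]] by blast
    have "G zg \<noteq> 0" using strict[of zg] zg(1) e by (force simp: K'_def)
    then have g: "G zg > 0" using G_nonneg[of zg] zg(1) K'_sub by force
    define N where "N = (F zf - F z0 + 1) / G zg"
    have N: "N > 0" using g zf(1) by (auto simp: N_def K'_def intro!: divide_pos_pos)
    show thesis
    proof (rule that[OF N])
      fix z assume z: "z \<in> K" "F z0 \<le> F z - N * G z"
      have "N * G z \<ge> 0" using N G_nonneg[OF z(1)] by simp
      with z have ge: "F z0 \<le> F z" by linarith
      show "dist z z0 < e"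
      proof (rule ccontr)
        assume "\<not> dist z z0 < e"
        then have "z \<in> K'" using z ge by (simp add: K'_def)
        then have "N * G zg \<le> N * G z" "F z \<le> F zf" using zg zf N by auto
        moreover have "N * G zg = F zf - F z0 + 1" using g by (simp add: N_def)
        ultimately show False using z by linarith
      qed
    qed
  qed
qed

section \<open>Restriction, translation and perturbation of superjets\<close>

lemma superjet_subset: "superjet S w z g \<Longrightarrow> T \<subseteq> S \<Longrightarrow> superjet T w z g"
  unfolding superjet_def by blast

text \<open>A superjet passes to any function whose increments are dominated. The shift
  \<open>d\<close> is the time displacement of a convolution in one use; in the other it is zero,
  and the domination comes from a maximum of a sum.\<close>

lemma superjet_transfer:
  assumes "superjet S w z g" and "r > 0"
    and "\<And>y. y \<in> S \<Longrightarrow> dist y z < r \<Longrightarrow> w' (y + d) - w' (z + d) \<le> w y - w z"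
  shows "superjet ((\<lambda>y. y + d) ` S) w' (z + d) g"
proof -
  obtain C r' where r': "r' > 0" and *: "\<And>y. y \<in> S \<Longrightarrow> dist y z < r' \<Longrightarrow> w y \<le> w z + g \<bullet> (y - z) + C * (norm (y - z))\<^sup>2"
    using assms(1) unfolding superjet_def by blast
  show ?thesis
  proof (rule superjetI)
    show "min r r' > 0" using assms(2) r' by simp
    fix y assume "y \<in> (\<lambda>y. y + d) ` S" "dist y (z + d) < min r r'"
    then obtain x where x: "x \<in> S" "y = x + d" "dist x z < r" "dist x z < r'" by auto
    show "w' y \<le> w' (z + d) + g \<bullet> (y - (z + d)) + C * (norm (y - (z + d)))\<^sup>2"
      using assms(3)[OF x(1,3)] *[OF x(1,4)] x(2) by simp
  qed
qed

lemma superjet_UNIV_of_strip: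
  fixes w :: "real \<times> real \<Rightarrow> real"
  assumes "superjet ({0..1} \<times> UNIV) w (s, t) (p, q)" and "s \<in> {0<..<1}"
  shows "superjet UNIV w (s, t) (p, q)"
proof -
  obtain C r where r: "r > 0" and *: "\<And>s' t'. (s', t') \<in> {0..1} \<times> (UNIV :: real set) \<Longrightarrow> \<bar>s' - s\<bar> < r \<Longrightarrow> \<bar>t' - t\<bar> < r \<Longrightarrow>
      w (s', t') \<le> w (s, t) + p * (s' - s) + q * (t' - t) + C * ((s' - s)\<^sup>2 + (t' - t)\<^sup>2)"
    using superjet_pairD[OF assms(1)] by metis
  show ?thesis
  proof (rule superjet_pairI[where r = "Min {r, s, 1 - s}" and C = C])
    fix s' t' :: real assume "\<bar>s' - s\<bar> < Min {r, s, 1 - s}" "\<bar>t' - t\<bar> < Min {r, s, 1 - s}"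
    then show "w (s', t') \<le> w (s, t) + p * (s' - s) + q * (t' - t) + C * ((s' - s)\<^sup>2 + (t' - t)\<^sup>2)"
      by (intro *) auto
  qed (use r assms(2) in auto)
qed

lemma superjet_add:
  assumes "superjet S w z g" and "\<And>y. y \<in> S \<Longrightarrow> f y \<le> f z + g' \<bullet> (y - z) + C' * (norm (y - z))\<^sup>2"
  shows "superjet S (\<lambda>y. w y + f y) z (g + g')"
proof -
  obtain C r where r: "r > 0" and *: "\<And>y. y \<in> S \<Longrightarrow> dist y z < r \<Longrightarrow> w y \<le> w z + g \<bullet> (y - z) + C * (norm (y - z))\<^sup>2"
    using assms(1) unfolding superjet_def by blast
  show ?thesis
  proof (rule superjetI[OF r, where C = "C + C'"])
    fix y assume "y \<in> S" "dist y z < r"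
    from *[OF this] assms(2)[OF this(1)]
    show "w y + f y \<le> w z + f z + (g + g') \<bullet> (y - z) + (C + C') * (norm (y - z))\<^sup>2"
      by (simp add: inner_add_left algebra_simps)
  qed
qed

section \<open>Semiconvex subsolutions on an arc\<close>

text \<open>This collects what the sup-convolution of a strict subsolution satisfies along one arc
  in a time window around \<open>t0\<close>. The support from below in time is required up to the
  ends of the arc, the equation only inside. Here \<open>Q\<close> bounds the time slopes,
  \<open>c\<close> is the semiconvexity constant and \<open>\<eta>\<close> the margin of
  strictness.\<close>

locale regularized_subsolution =
  fixes h :: "real \<Rightarrow> real \<Rightarrow> real" and U :: "real \<times> real \<Rightarrow> real" and t0 r Q c \<eta> :: real
  assumes h_cont: "continuous_on ({0..1} \<times> UNIV) (\<lambda>(s, p). h s p)"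
    and h_coercive: "\<And>K. \<exists>R. \<forall>s\<in>{0..1}. \<forall>p. R \<le> \<bar>p\<bar> \<longrightarrow> K \<le> h s p"
    and r_pos: "r > 0" and eta_pos: "\<eta> > 0" and c_nonneg: "c \<ge> 0"
    and U_cont: "continuous_on ({0..1} \<times> {t0 - r..t0 + r}) U"
    and U_semiconvex: "\<And>s t. s \<in> {0..1} \<Longrightarrow> \<bar>t - t0\<bar> \<le> r \<Longrightarrow>
      \<exists>q. \<bar>q\<bar> \<le> Q \<and> (\<forall>t'. \<bar>t' - t0\<bar> \<le> r \<longrightarrow> U (s, t) + q * (t' - t) - c * (t' - t)\<^sup>2 \<le> U (s, t'))"
    and U_sub: "\<And>s t p q. s \<in> {0<..<1} \<Longrightarrow> \<bar>t - t0\<bar> < r \<Longrightarrow> superjet UNIV U (s, t) (p, q) \<Longrightarrow>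
      q + h s p \<le> - \<eta>"
begin

text \<open>The time slope of a superjet is that of the supporting parabola, hence at least
  \<open>- Q\<close>. The equation then bounds \<open>h s p\<close> from above, and coercivity
  bounds \<open>p\<close>.\<close>

lemma superjet_slope_bounded:
  obtains R where "R > 0"
    and "\<And>s t p q. s \<in> {0<..<1} \<Longrightarrow> \<bar>t - t0\<bar> < r \<Longrightarrow> superjet UNIV U (s, t) (p, q) \<Longrightarrow> \<bar>p\<bar> < R"
proof -
  obtain R where R: "\<And>s p. s \<in> {0..1} \<Longrightarrow> R \<le> \<bar>p\<bar> \<Longrightarrow> Q \<le> h s p"
    using h_coercive[of Q] by blast
  show thesis
  proof (rule that[of "max 1 R"])
    fix s t p q assume st: "s \<in> {0<..<1}" "\<bar>t - t0\<bar> < r" and jet: "superjet UNIV U (s, t) (p, q)"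
    obtain q' where q': "\<bar>q'\<bar> \<le> Q"
      and semi: "\<And>t'. \<bar>t' - t0\<bar> \<le> r \<Longrightarrow> U (s, t) + q' * (t' - t) - c * (t' - t)\<^sup>2 \<le> U (s, t')"
      using U_semiconvex[of s t] st by (metis greaterThanLessThan_iff atLeastAtMost_iff less_imp_le)
    have "q = q'"
    proof (rule superjet_time_slope[OF jet])
      show "r - \<bar>t - t0\<bar> > 0" using st by simp
      show "U (s, t) + q' * (t' - t) - c * (t' - t)\<^sup>2 \<le> U (s, t')" if "\<bar>t' - t\<bar> < r - \<bar>t - t0\<bar>" for t'
        using that by (intro semi) linarith
    qed
    then have "h s p \<le> Q - \<eta>" using U_sub[OF st jet] q' by linarith
    then have "h s p < Q" using eta_pos by linarith
    then show "\<bar>p\<bar> < max 1 R" using R[of s p] st by force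
  qed simp
qed

lemma lipschitz_in_space:
  obtains L where "L > 0"
    and "\<And>s s' t. s \<in> {0..1} \<Longrightarrow> s' \<in> {0..1} \<Longrightarrow> \<bar>t - t0\<bar> < r \<Longrightarrow> \<bar>U (s, t) - U (s', t)\<bar> \<le> L * \<bar>s - s'\<bar>"
proof -
  obtain R where R: "R > 0"
    and slope: "\<And>s t p q. s \<in> {0<..<1} \<Longrightarrow> \<bar>t - t0\<bar> < r \<Longrightarrow> superjet UNIV U (s, t) (p, q) \<Longrightarrow> \<bar>p\<bar> < R"
    using superjet_slope_bounded by blast
  \<comment> \<open>The increment lemma controls growth to the right only. Reflecting the arc
    reverses the sign of space slopes and yields the bound on decrease.\<close>
  define W :: "real \<times> real \<Rightarrow> real" where "W = (\<lambda>z. U (1 - fst z, snd z))"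
  have W_cont: "continuous_on ({0..1} \<times> {t0 - r..t0 + r}) W"
    unfolding W_def
    by (rule continuous_on_compose2[OF U_cont]) (auto intro!: continuous_intros)
  have W_slope: "p < R" if st: "s \<in> {0<..<1}" "\<bar>t - t0\<bar> < r" and jet: "superjet UNIV W (s, t) (p, q)" for s t p q
  proof -
    obtain C d where d: "d > 0" and *: "\<And>s' t'. (s', t') \<in> UNIV \<Longrightarrow> \<bar>s' - s\<bar> < d \<Longrightarrow> \<bar>t' - t\<bar> < d \<Longrightarrow>
      W (s', t') \<le> W (s, t) + p * (s' - s) + q * (t' - t) + C * ((s' - s)\<^sup>2 + (t' - t)\<^sup>2)"
      using superjet_pairD[OF jet] by metis
    have "superjet UNIV U (1 - s, t) (- p, q)"
    proof (rule superjet_pairI[OF d, where C = C])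
      fix s' t' assume "\<bar>s' - (1 - s)\<bar> < d" "\<bar>t' - t\<bar> < d"
      then have "U (s', t') \<le> U (1 - s, t) + p * (1 - s' - s) + q * (t' - t) + C * ((1 - s' - s)\<^sup>2 + (t' - t)\<^sup>2)"
        using *[of "1 - s'" t'] by (simp add: W_def)
      moreover have "(1 - s' - s)\<^sup>2 = (s' - (1 - s))\<^sup>2" by (simp add: power2_eq_square algebra_simps)
      ultimately show "U (s', t') \<le> U (1 - s, t) + - p * (s' - (1 - s)) + q * (t' - t) + C * ((s' - (1 - s))\<^sup>2 + (t' - t)\<^sup>2)"
        by (simp add: algebra_simps)
    qed
    then have "\<bar>- p\<bar> < R" using slope[of "1 - s" t "- p" q] st by auto
    then show ?thesis by linarith
  qed
  have inc: "U (s', t) \<le> U (s, t) + R * (s' - s)" "U (s, t) \<le> U (s', t) + R * (s' - s)"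
    if "0 \<le> s" "s \<le> s'" "s' \<le> 1" "\<bar>t - t0\<bar> < r" for s s' t
  proof -
    have t: "t \<in> {t0 - r<..<t0 + r}" using that by auto
    show "U (s', t) \<le> U (s, t) + R * (s' - s)"
    proof (rule increment_le_of_superjet_slopes[OF U_cont t])
      show "p < R" if "s \<in> {0<..<1}" "t \<in> {t0 - r<..<t0 + r}" "superjet UNIV U (s, t) (p, q)" for s t p q
      proof -
        have "\<bar>t - t0\<bar> < r" using that by (auto simp: abs_less_iff)
        then have "\<bar>p\<bar> < R" using slope that by blast
        then show ?thesis by linarith
      qed
    qed (use that R in auto)
    have "W (1 - s, t) \<le> W (1 - s', t) + R * ((1 - s) - (1 - s'))"
    proof (rule increment_le_of_superjet_slopes[OF W_cont t])
      show "p < R" if "s \<in> {0<..<1}" "t \<in> {t0 - r<..<t0 + r}" "superjet UNIV W (s, t) (p, q)" for s t p q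
        using W_slope[of s t p q] that by (auto simp: abs_less_iff)
    qed (use that R in auto)
    then show "U (s, t) \<le> U (s', t) + R * (s' - s)" by (simp add: W_def)
  qed
  show thesis
  proof (rule that[OF R])
    fix s s' t :: real assume st: "s \<in> {0..1}" "s' \<in> {0..1}" "\<bar>t - t0\<bar> < r"
    show "\<bar>U (s, t) - U (s', t)\<bar> \<le> R * \<bar>s - s'\<bar>"
    proof (cases "s \<le> s'")
      case True
      with inc[of s s' t] st show ?thesis by (auto simp: abs_le_iff algebra_simps)
    next
      case False
      with inc[of s' s t] st show ?thesis by (auto simp: abs_le_iff algebra_simps)
    qed
  qed
qed

text \<open>At \<open>(1, t0)\<close> the parabola from above and semiconvexity make
  \<open>U\<close> differentiable in time with slope \<open>q\<close>. Lipschitz continuity in space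
  carries this to nearby points: supporting time slopes at \<open>(s, t)\<close> differ from
  \<open>q\<close> by at most a multiple of \<open>sqrt (1 - s) + \<bar>t - t0\<bar>\<close>. The
  square root appears because a time step \<open>z\<close> must compensate a space error of order
  \<open>1 - s\<close>, and \<open>z = sqrt (1 - s)\<close> balances the two. Young's inequality
  turns the resulting mixed term into one that is arbitrarily small relative to
  \<open>1 - s\<close>.\<close>

lemma time_expansion_near_end:
  assumes U_end: "\<And>t. \<bar>t - t0\<bar> \<le> r \<Longrightarrow> U (1, t) \<le> U (1, t0) + q * (t - t0) + c * (t - t0)\<^sup>2"
    and eps: "\<epsilon> > 0"
  obtains C d where "d > 0" "d < 1" "C \<ge> 0"
    and "\<And>s t. s \<in> {1 - d..1} \<Longrightarrow> \<bar>t - t0\<bar> \<le> r / 4 \<Longrightarrow>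
      \<bar>U (s, t) - U (s, t0) - q * (t - t0)\<bar> \<le> \<epsilon> * (1 - s) + C * (t - t0)\<^sup>2"
proof -
  obtain L where L: "L > 0" and lip: "\<And>s s' t. s \<in> {0..1} \<Longrightarrow> s' \<in> {0..1} \<Longrightarrow> \<bar>t - t0\<bar> < r \<Longrightarrow>
      \<bar>U (s, t) - U (s', t)\<bar> \<le> L * \<bar>s - s'\<bar>"
    using lipschitz_in_space by blast
  obtain q0 where q0: "\<And>t. \<bar>t - t0\<bar> \<le> r \<Longrightarrow> U (1, t0) + q0 * (t - t0) - c * (t - t0)\<^sup>2 \<le> U (1, t)"
    using U_semiconvex[of 1 t0] r_pos by auto
  have "q0 - q = 0"
  proof (rule slope_eq_0[OF r_pos])
    show "(q0 - q) * \<tau> \<le> (2 * c) * \<tau>\<^sup>2" if "\<bar>\<tau>\<bar> < r" for \<tau>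
      using q0[of "t0 + \<tau>"] U_end[of "t0 + \<tau>"] that by (simp add: algebra_simps)
  qed
  with q0 have U_end': "\<And>t. \<bar>t - t0\<bar> \<le> r \<Longrightarrow> U (1, t0) + q * (t - t0) - c * (t - t0)\<^sup>2 \<le> U (1, t)"
    by simp
  \<comment> \<open>Over a time step of length \<open>z\<close> the curvature errors are
    \<open>c\<close> at \<open>(1, t)\<close>, \<open>4 * c\<close> at the displaced time, which is
    within \<open>2 * z\<close> of \<open>t0\<close>, and \<open>c\<close> from the supporting
    parabola at \<open>(s, t)\<close>. Each passage between \<open>s\<close> and \<open>1\<close>
    costs \<open>L\<close>. All are in units of \<open>z\<^sup>2\<close>.\<close>
  define C1 where "C1 = 6 * c + 2 * L"
  have C1: "C1 > 0" using c_nonneg L by (simp add: C1_def)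
  have slope: "\<bar>q' - q\<bar> \<le> C1 * z"
    if s: "s \<in> {0..1}" "1 - s \<le> z\<^sup>2" and t: "\<bar>t - t0\<bar> \<le> z" and z: "z > 0" "z < r / 2"
      and semi: "\<And>t'. \<bar>t' - t0\<bar> \<le> r \<Longrightarrow> U (s, t) + q' * (t' - t) - c * (t' - t)\<^sup>2 \<le> U (s, t')"
    for s t z q'
  proof -
    have lower: "U (1, t0) + q * (t - t0) - c * z\<^sup>2 - L * z\<^sup>2 \<le> U (s, t)"
    proof -
      have "\<bar>U (1, t) - U (s, t)\<bar> \<le> L * \<bar>1 - s\<bar>" using s t z by (intro lip) auto
      also have "\<dots> \<le> L * z\<^sup>2" using s L by simp
      finally have "U (1, t) - L * z\<^sup>2 \<le> U (s, t)" by linarith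
      moreover have "c * (t - t0)\<^sup>2 \<le> c * z\<^sup>2"
        using t c_nonneg by (intro mult_left_mono abs_le_square_iff[THEN iffD1]) auto
      moreover have "\<bar>t - t0\<bar> \<le> r" using t z by linarith
      ultimately show ?thesis using U_end'[of t] by linarith
    qed
    have "(q' - q) * \<sigma> \<le> C1 * z\<^sup>2" if \<sigma>: "\<bar>\<sigma>\<bar> = z" for \<sigma>
    proof -
      have t\<sigma>: "\<bar>t + \<sigma> - t0\<bar> \<le> 2 * z" using t \<sigma> by linarith
      have "\<bar>U (1, t + \<sigma>) - U (s, t + \<sigma>)\<bar> \<le> L * \<bar>1 - s\<bar>" using s t\<sigma> z by (intro lip) auto
      also have "\<dots> \<le> L * z\<^sup>2" using s L by simp
      finally have "U (s, t + \<sigma>) \<le> U (1, t + \<sigma>) + L * z\<^sup>2" by linarith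
      moreover have "U (1, t + \<sigma>) \<le> U (1, t0) + q * (t + \<sigma> - t0) + c * (t + \<sigma> - t0)\<^sup>2"
        using t\<sigma> z by (intro U_end) linarith
      moreover have "c * (t + \<sigma> - t0)\<^sup>2 \<le> c * (2 * z)\<^sup>2"
        using t\<sigma> z c_nonneg by (intro mult_left_mono abs_le_square_iff[THEN iffD1]) auto
      moreover have "U (s, t) + q' * \<sigma> - c * \<sigma>\<^sup>2 \<le> U (s, t + \<sigma>)"
        using semi[of "t + \<sigma>"] t\<sigma> z by auto
      moreover have "c * \<sigma>\<^sup>2 = c * z\<^sup>2" using \<sigma> by (metis power2_abs)
      ultimately show ?thesis using lower by (simp add: C1_def power_mult_distrib algebra_simps)
    qed
    from this[of z] this[of "- z"] z have *: "(q' - q) * z \<le> (C1 * z) * z" "(q - q') * z \<le> (C1 * z) * z"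
      by (simp_all add: power2_eq_square algebra_simps)
    have "q' - q \<le> C1 * z" "q - q' \<le> C1 * z"
      using mult_right_le_imp_le[OF *(1) z(1)] mult_right_le_imp_le[OF *(2) z(1)] .
    then show ?thesis by linarith
  qed
  \<comment> \<open>Chosen to complete the square:
    \<open>\<epsilon> * (y - D * \<bar>t - t0\<bar>)\<^sup>2\<close> has mixed term
    \<open>C1 * y * \<bar>t - t0\<bar>\<close>, and \<open>y\<^sup>2 = 1 - s\<close>.\<close>
  define D where "D = C1 / (2 * \<epsilon>)"
  have D: "2 * \<epsilon> * D = C1" using eps by (simp add: D_def)
  define C where "C = \<epsilon> * D\<^sup>2 + C1 + c"
  \<comment> \<open>Since \<open>1/5 + 1/4 < 1/2\<close>, the step \<open>z\<close> stays below
    \<open>r / 2\<close>, and times within \<open>2 * z\<close> of \<open>t0\<close> stay in the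
    window.\<close>
  define d where "d = min (1 / 2) ((r / 5)\<^sup>2)"
  have d: "d > 0" "d < 1" using r_pos by (auto simp: d_def)
  have C: "C \<ge> 0" using C1 c_nonneg eps by (simp add: C_def)
  show thesis
  proof (rule that[OF d C])
    fix s t assume s: "s \<in> {1 - d..1}" and t: "\<bar>t - t0\<bar> \<le> r / 4"
    define y where "y = sqrt (1 - s)"
    have y: "y \<ge> 0" "y\<^sup>2 = 1 - s" using s by (auto simp: y_def)
    have "y\<^sup>2 \<le> (r / 5)\<^sup>2" using s y by (auto simp: d_def)
    then have "y \<le> r / 5" by (rule power2_le_imp_le) (use r_pos in simp)
    define z where "z = y + \<bar>t - t0\<bar>"
    have s01: "s \<in> {0..1}" using s d by auto
    show "\<bar>U (s, t) - U (s, t0) - q * (t - t0)\<bar> \<le> \<epsilon> * (1 - s) + C * (t - t0)\<^sup>2"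
    proof (cases "z = 0")
      case True
      then have "t = t0" "y = 0" using y by (auto simp: z_def)
      then show ?thesis using y by simp
    next
      case False
      then have z: "z > 0" "z < r / 2" "\<bar>t - t0\<bar> \<le> z" using y t r_pos \<open>y \<le> r / 5\<close> by (auto simp: z_def)
      have "y\<^sup>2 \<le> z\<^sup>2" using y by (intro power_mono) (auto simp: z_def)
      then have sz: "1 - s \<le> z\<^sup>2" using y by simp
      have bound: "C1 * z * \<bar>t - t0\<bar> + c * (t - t0)\<^sup>2 \<le> \<epsilon> * (1 - s) + C * (t - t0)\<^sup>2"
      proof -
        have "0 \<le> \<epsilon> * (y - D * \<bar>t - t0\<bar>)\<^sup>2" using eps by simp
        also have "\<dots> = \<epsilon> * y\<^sup>2 - (2 * \<epsilon> * D) * y * \<bar>t - t0\<bar> + \<epsilon> * D\<^sup>2 * \<bar>t - t0\<bar>\<^sup>2"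
          unfolding power2_diff power_mult_distrib by (simp only: algebra_simps)
        finally have "C1 * y * \<bar>t - t0\<bar> \<le> \<epsilon> * y\<^sup>2 + \<epsilon> * D\<^sup>2 * \<bar>t - t0\<bar>\<^sup>2" using D by simp
        moreover have "C1 * z * \<bar>t - t0\<bar> = C1 * y * \<bar>t - t0\<bar> + C1 * \<bar>t - t0\<bar>\<^sup>2"
          by (simp add: z_def power2_eq_square algebra_simps)
        ultimately show ?thesis by (simp add: C_def y(2)[symmetric] algebra_simps)
      qed
      have le: "\<bar>(q' - q) * (t - t0)\<bar> \<le> C1 * z * \<bar>t - t0\<bar>" if "\<bar>q' - q\<bar> \<le> C1 * z" for q'
        using that by (simp add: abs_mult mult_right_mono)
      obtain q1 where q1: "\<And>t'. \<bar>t' - t0\<bar> \<le> r \<Longrightarrow> U (s, t0) + q1 * (t' - t0) - c * (t' - t0)\<^sup>2 \<le> U (s, t')"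
        using U_semiconvex[of s t0] s01 r_pos by auto
      have tr: "\<bar>t - t0\<bar> \<le> r" using t r_pos by linarith
      obtain q2 where q2: "\<And>t'. \<bar>t' - t0\<bar> \<le> r \<Longrightarrow> U (s, t) + q2 * (t' - t) - c * (t' - t)\<^sup>2 \<le> U (s, t')"
        using U_semiconvex[of s t] s01 tr by auto
      have "\<bar>q1 - q\<bar> \<le> C1 * z" using z by (intro slope[OF s01 sz _ _ _ q1]) auto
      from le[OF this] q1[OF tr]
      have 1: "- (C1 * z * \<bar>t - t0\<bar> + c * (t - t0)\<^sup>2) \<le> U (s, t) - U (s, t0) - q * (t - t0)"
        by (simp add: abs_le_iff algebra_simps)
      have "\<bar>q2 - q\<bar> \<le> C1 * z" using z by (intro slope[OF s01 sz _ _ _ q2]) auto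
      from le[OF this] q2[of t0]
      have 2: "U (s, t) - U (s, t0) - q * (t - t0) \<le> C1 * z * \<bar>t - t0\<bar> + c * (t - t0)\<^sup>2"
        using r_pos by (simp add: abs_le_iff algebra_simps power2_commute)
      show ?thesis using 1 2 bound by linarith
    qed
  qed
qed

section \<open>The two contradictions: inside an arc and at its end\<close>

lemma h_uniformly_continuous:
  assumes "e > 0"
  obtains d where "d > 0"
    and "\<And>s s' p p'. s \<in> {0..1} \<Longrightarrow> s' \<in> {0..1} \<Longrightarrow> \<bar>p\<bar> \<le> B \<Longrightarrow> \<bar>p'\<bar> \<le> B \<Longrightarrow>
      \<bar>s - s'\<bar> < d \<Longrightarrow> \<bar>p - p'\<bar> < d \<Longrightarrow> \<bar>h s p - h s' p'\<bar> < e"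
proof -
  have "uniformly_continuous_on ({0..1} \<times> {- B..B}) (\<lambda>(s, p). h s p)"
    by (intro compact_uniformly_continuous continuous_on_subset[OF h_cont] compact_Times compact_Icc) auto
  then obtain d where d: "d > 0" and *: "\<And>z z'. z \<in> {0..1} \<times> {- B..B} \<Longrightarrow> z' \<in> {0..1} \<times> {- B..B} \<Longrightarrow>
      dist z' z < d \<Longrightarrow> dist (case z' of (s, p) \<Rightarrow> h s p) (case z of (s, p) \<Rightarrow> h s p) < e"
    using assms unfolding uniformly_continuous_on_def by metis
  show thesis
  proof (rule that[of "d / 2"])
    fix s s' p p' :: real
    assume a: "s \<in> {0..1}" "s' \<in> {0..1}" "\<bar>p\<bar> \<le> B" "\<bar>p'\<bar> \<le> B" "\<bar>s - s'\<bar> < d / 2" "\<bar>p - p'\<bar> < d / 2"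
    have "dist (s, p) (s', p') \<le> \<bar>s - s'\<bar> + \<bar>p - p'\<bar>"
      using norm_Pair_le[of "s - s'" "p - p'"] by (simp add: dist_norm)
    then have "dist (s, p) (s', p') < d" using a by linarith
    then show "\<bar>h s p - h s' p'\<bar> < e"
      using *[of "(s', p')" "(s, p)"] a by (auto simp: dist_real_def abs_le_iff)
  qed (use d in simp)
qed

text \<open>
  Doubling the space variable only: semiconvexity of \<open>U\<close> and semiconcavity of \<open>V\<close> in time provide
  the time part of the test functions.
\<close>

lemma no_interior_max:
  assumes V_cont: "continuous_on ({0..1} \<times> {t0 - r..t0 + r}) V"
    and V_semiconcave: "\<And>s t. s \<in> {0..1} \<Longrightarrow> \<bar>t - t0\<bar> \<le> r \<Longrightarrow>
      \<exists>q. \<forall>t'. \<bar>t' - t0\<bar> \<le> r \<longrightarrow> V (s, t') \<le> V (s, t) + q * (t' - t) + c * (t' - t)\<^sup>2"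
    and V_super: "\<And>s t p q. s \<in> {0<..<1} \<Longrightarrow> \<bar>t - t0\<bar> < r \<Longrightarrow>
      superjet UNIV (\<lambda>z. - V z) (s, t) (- p, - q) \<Longrightarrow> 0 \<le> q + h s p"
    and max: "\<And>s t. s \<in> {0..1} \<Longrightarrow> \<bar>t - t0\<bar> \<le> r \<Longrightarrow> U (s, t) - V (s, t) \<le> U (s0, t0) - V (s0, t0)"
    and s0: "s0 \<in> {0<..<1}"
  shows False
proof -
  obtain R where R: "R > 0"
    and slope: "\<And>s t p q. s \<in> {0<..<1} \<Longrightarrow> \<bar>t - t0\<bar> < r \<Longrightarrow> superjet UNIV U (s, t) (p, q) \<Longrightarrow> \<bar>p\<bar> < R"
    using superjet_slope_bounded by blast
  obtain \<rho> where \<rho>: "\<rho> > 0"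
    and h_close: "\<And>s s' p p'. s \<in> {0..1} \<Longrightarrow> s' \<in> {0..1} \<Longrightarrow> \<bar>p\<bar> \<le> R + 2 \<Longrightarrow> \<bar>p'\<bar> \<le> R + 2 \<Longrightarrow>
      \<bar>s - s'\<bar> < \<rho> \<Longrightarrow> \<bar>p - p'\<bar> < \<rho> \<Longrightarrow> \<bar>h s p - h s' p'\<bar> < \<eta> / 2"
    using h_uniformly_continuous[of "\<eta> / 2" "R + 2"] eta_pos by (metis half_gt_zero)
  \<comment> \<open>The first three entries keep the maximizer inside the arc and the window. The
    bound \<open>\<rho> / 2\<close> makes both \<open>s - s'\<close> and the slope error
    \<open>2 * (s - s0)\<close> admissible in \<open>h_close\<close>, \<open>\<eta> / 4\<close>
    keeps the time error \<open>2 * (t - t0)\<close> below \<open>\<eta> / 2\<close>, and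
    \<open>1\<close> explains the \<open>R + 2\<close> above.\<close>
  define e where "e = Min {s0, 1 - s0, r, \<rho> / 2, \<eta> / 4, 1}"
  have "e \<le> \<rho> / 2" "e \<le> \<eta> / 4" unfolding e_def by (rule Min_le, simp, simp)+
  then have e_small: "2 * e \<le> \<rho>" "4 * e \<le> \<eta>" by linarith+
  have e: "e > 0" "e \<le> s0" "e \<le> 1 - s0" "e \<le> r" "e \<le> 1"
    using s0 r_pos \<rho> eta_pos by (auto simp: e_def)
  define K :: "((real \<times> real) \<times> real) set" where "K = ({0..1} \<times> {0..1}) \<times> {t0 - r..t0 + r}"
  \<comment> \<open>The subtracted squares turn the given maximum into a strict one on the diagonal;
    they are the source of the errors \<open>2 * (s - s0)\<close> and \<open>2 * (t - t0)\<close> in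
    the jets.\<close>
  define F where "F = (\<lambda>z :: (real \<times> real) \<times> real. U (fst (fst z), snd z) - V (snd (fst z), snd z)
      - (fst (fst z) - s0)\<^sup>2 - (snd z - t0)\<^sup>2)"
  define G where "G = (\<lambda>z :: (real \<times> real) \<times> real. (fst (fst z) - snd (fst z))\<^sup>2)"
  define z0 where "z0 = ((s0, s0), t0)"
  have K: "compact K" unfolding K_def by (intro compact_Times compact_Icc)
  have F_cont: "continuous_on K F"
    unfolding F_def K_def
    by (intro continuous_intros continuous_on_compose2[OF U_cont] continuous_on_compose2[OF V_cont]) auto
  have G_cont: "continuous_on K G"
    unfolding G_def by (intro continuous_intros)
  obtain N where N: "N > 0" and near: "\<And>z. z \<in> K \<Longrightarrow> F z0 \<le> F z - N * G z \<Longrightarrow> dist z z0 < e"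
  proof (rule penalized_argmax_near[OF K F_cont G_cont _ _ e(1), of z0])
    show "0 \<le> G z" for z by (simp add: G_def)
    fix z assume z: "z \<in> K" "G z = 0" "z \<noteq> z0"
    obtain s s' t where z_eq: "z = ((s, s'), t)" by (metis surj_pair)
    have [simp]: "s' = s" using z z_eq by (simp add: G_def)
    have "U (s, t) - V (s, t) \<le> U (s0, t0) - V (s0, t0)"
      using z z_eq by (intro max) (auto simp: K_def abs_le_iff)
    moreover have "s \<noteq> s0 \<or> t \<noteq> t0" using z z_eq by (auto simp: z0_def)
    then have "0 < (s - s0)\<^sup>2 + (t - t0)\<^sup>2" by (simp add: sum_power2_gt_zero_iff)
    ultimately show "F z < F z0" by (simp add: F_def z_eq z0_def)
  qed blast
  have z0_K: "z0 \<in> K" using s0 r_pos by (auto simp: z0_def K_def)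
  have "continuous_on K (\<lambda>z. F z - N * G z)"
    by (intro continuous_intros F_cont G_cont)
  then obtain z where z: "z \<in> K" and z_max: "\<And>y. y \<in> K \<Longrightarrow> F y - N * G y \<le> F z - N * G z"
    using continuous_attains_sup[OF K, of "\<lambda>z. F z - N * G z"] z0_K by blast
  have "F z0 \<le> F z - N * G z" using z_max[OF z0_K] by (simp add: G_def z0_def)
  then have dist: "dist z z0 < e" using near z by blast
  obtain s s' t where z_eq: "z = ((s, s'), t)" by (metis surj_pair)
  have st: "\<bar>s - s0\<bar> < e" "\<bar>s' - s0\<bar> < e" "\<bar>t - t0\<bar> < e"
  proof -
    have "dist (s, s') (s0, s0) < e" "dist t t0 < e"
      using dist dist_fst_le[of z z0] dist_snd_le[of z z0] unfolding z_eq z0_def fst_conv snd_conv by linarith+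
    moreover have "dist s s0 \<le> dist (s, s') (s0, s0)" "dist s' s0 \<le> dist (s, s') (s0, s0)"
      using dist_fst_le[of "(s, s')" "(s0, s0)"] dist_snd_le[of "(s, s')" "(s0, s0)"] by simp_all
    ultimately show "\<bar>s - s0\<bar> < e" "\<bar>s' - s0\<bar> < e" "\<bar>t - t0\<bar> < e"
      unfolding dist_real_def by linarith+
  qed
  have s: "s \<in> {0<..<1}" "s' \<in> {0<..<1}" and t: "\<bar>t - t0\<bar> < r" "t \<in> {t0 - r<..<t0 + r}"
    using st e by (auto simp: abs_less_iff)
  have s01: "s \<in> {0..1}" "s' \<in> {0..1}" and tr: "\<bar>t - t0\<bar> \<le> r" using s t by auto
  have max': "U (x, y) - V (x', y) - (x - s0)\<^sup>2 - (y - t0)\<^sup>2 - N * (x - x')\<^sup>2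
      \<le> U (s, t) - V (s', t) - (s - s0)\<^sup>2 - (t - t0)\<^sup>2 - N * (s - s')\<^sup>2"
    if "x \<in> {0..1}" "x' \<in> {0..1}" "y \<in> {t0 - r..t0 + r}" for x x' y :: real
    using z_max[of "((x, x'), y)"] that by (simp add: K_def F_def G_def z_eq)
  obtain qu where qu: "\<And>t'. \<bar>t' - t0\<bar> \<le> r \<Longrightarrow> U (s, t) + qu * (t' - t) - c * (t' - t)\<^sup>2 \<le> U (s, t')"
    using U_semiconvex[OF s01(1) tr] by blast
  obtain qv where qv: "\<And>t'. \<bar>t' - t0\<bar> \<le> r \<Longrightarrow> V (s', t') \<le> V (s', t) + qv * (t' - t) + c * (t' - t)\<^sup>2"
    using V_semiconcave[OF s01(2) tr] by blast
  define p where "p = 2 * N * (s - s')"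
  have jet_U: "superjet UNIV U (s, t) (p + 2 * (s - s0), qv + 2 * (t - t0))"
  proof (rule superjet_boxI[OF s(1) t(2), where C = "N + c + 1"])
    fix x y :: real assume xy: "x \<in> {0..1}" "y \<in> {t0 - r..t0 + r}"
    have "U (x, y) \<le> U (s, t) + (V (s', y) - V (s', t)) + ((x - s0)\<^sup>2 - (s - s0)\<^sup>2)
        + ((y - t0)\<^sup>2 - (t - t0)\<^sup>2) + N * ((x - s')\<^sup>2 - (s - s')\<^sup>2)"
      using max'[of x s' y] xy s by (simp add: algebra_simps)
    also have "\<dots> \<le> U (s, t) + (qv * (y - t) + c * (y - t)\<^sup>2) + ((x - s0)\<^sup>2 - (s - s0)\<^sup>2)
        + ((y - t0)\<^sup>2 - (t - t0)\<^sup>2) + N * ((x - s')\<^sup>2 - (s - s')\<^sup>2)"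
      using qv[of y] xy by (auto simp: abs_le_iff)
    also have "\<dots> = U (s, t) + (p + 2 * (s - s0)) * (x - s) + (qv + 2 * (t - t0)) * (y - t)
        + ((N + 1) * (x - s)\<^sup>2 + (c + 1) * (y - t)\<^sup>2)"
      by (simp add: p_def power2_eq_square algebra_simps)
    also have "(N + 1) * (x - s)\<^sup>2 + (c + 1) * (y - t)\<^sup>2 \<le> (N + c + 1) * ((x - s)\<^sup>2 + (y - t)\<^sup>2)"
      using N c_nonneg by (simp add: distrib_left add_mono mult_right_mono)
    finally show "U (x, y) \<le> U (s, t) + (p + 2 * (s - s0)) * (x - s) + (qv + 2 * (t - t0)) * (y - t)
        + (N + c + 1) * ((x - s)\<^sup>2 + (y - t)\<^sup>2)" by simp
  qed
  have jet_V: "superjet UNIV (\<lambda>z. - V z) (s', t) (- p, - (qu - 2 * (t - t0)))"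
  proof (rule superjet_boxI[OF s(2) t(2), where C = "N + c + 1"])
    fix x y :: real assume xy: "x \<in> {0..1}" "y \<in> {t0 - r..t0 + r}"
    have "- V (x, y) \<le> - V (s', t) - (U (s, y) - U (s, t))
        + ((y - t0)\<^sup>2 - (t - t0)\<^sup>2) + N * ((s - x)\<^sup>2 - (s - s')\<^sup>2)"
      using max'[of s x y] xy s by (simp add: algebra_simps)
    also have "\<dots> \<le> - V (s', t) - (qu * (y - t) - c * (y - t)\<^sup>2)
        + ((y - t0)\<^sup>2 - (t - t0)\<^sup>2) + N * ((s - x)\<^sup>2 - (s - s')\<^sup>2)"
      using qu[of y] xy by (auto simp: abs_le_iff)
    also have "\<dots> = - V (s', t) + - p * (x - s') + - (qu - 2 * (t - t0)) * (y - t)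
        + (N * (x - s')\<^sup>2 + (c + 1) * (y - t)\<^sup>2)"
      by (simp add: p_def power2_eq_square algebra_simps)
    also have "N * (x - s')\<^sup>2 + (c + 1) * (y - t)\<^sup>2 \<le> (N + c + 1) * ((x - s')\<^sup>2 + (y - t)\<^sup>2)"
      using N c_nonneg by (simp add: distrib_left add_mono mult_right_mono)
    finally show "- V (x, y) \<le> - V (s', t) + - p * (x - s') + - (qu - 2 * (t - t0)) * (y - t)
        + (N + c + 1) * ((x - s')\<^sup>2 + (y - t)\<^sup>2)" by simp
  qed
  \<comment> \<open>The jet of \<open>U\<close> has a time slope taken from \<open>V\<close> and the
    jet of \<open>V\<close> one taken from \<open>U\<close>. Identifying them leaves only the small
    discrepancy \<open>2 * (t - t0)\<close> between the two inequalities.\<close>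
  have "qv + 2 * (t - t0) = qu"
  proof (rule superjet_time_slope[OF jet_U])
    show "r - \<bar>t - t0\<bar> > 0" using t by simp
    show "U (s, t) + qu * (t' - t) - c * (t' - t)\<^sup>2 \<le> U (s, t')" if "\<bar>t' - t\<bar> < r - \<bar>t - t0\<bar>" for t'
      using that by (intro qu) linarith
  qed
  then have 1: "qu + h s (p + 2 * (s - s0)) \<le> - \<eta>" using U_sub[OF s(1) t(1) jet_U] by simp
  have 2: "0 \<le> qu - 2 * (t - t0) + h s' p" using V_super[OF s(2) t(1) jet_V] .
  have "\<bar>p + 2 * (s - s0)\<bar> < R" using slope[OF s(1) t(1) jet_U] .
  then have "\<bar>h s (p + 2 * (s - s0)) - h s' p\<bar> < \<eta> / 2"
    using s st e e_small by (intro h_close) (auto simp: abs_less_iff abs_le_iff)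
  then have "h s' p - h s (p + 2 * (s - s0)) < \<eta> / 2" by linarith
  moreover have "2 * (t - t0) + \<eta> \<le> h s' p - h s (p + 2 * (s - s0))" using 1 2 by linarith
  moreover have "- (\<eta> / 2) < 2 * x" if "\<bar>x\<bar> < e" for x using that e_small(2) by linarith
  then have "- (\<eta> / 2) < 2 * (t - t0)" using st(3) by blast
  ultimately show False by linarith
qed

text \<open>
  The critical slope \<open>p\<close> at the end point is the limit superior of the difference quotients of
  \<open>U (\<cdot>, t0)\<close> at \<open>1\<close>. Slightly larger slopes support \<open>U\<close> from below at \<open>(1, t0)\<close>, while
  near-optimal chords, perturbed by a small concave bump, touch \<open>U\<close> from above at interior points.
\<close>

lemma no_end_subjets:
  assumes U_end: "\<And>t. \<bar>t - t0\<bar> \<le> r \<Longrightarrow> U (1, t) \<le> U (1, t0) + q * (t - t0) + c * (t - t0)\<^sup>2"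
    and end_super: "\<And>p. superjet ({0..1} \<times> UNIV) (\<lambda>z. - U z) (1, t0) (- p, - q) \<Longrightarrow> 0 \<le> q + h 1 p"
  shows False
proof -
  obtain L where L: "L > 0" and lip: "\<And>s s' t. s \<in> {0..1} \<Longrightarrow> s' \<in> {0..1} \<Longrightarrow> \<bar>t - t0\<bar> < r \<Longrightarrow>
      \<bar>U (s, t) - U (s', t)\<bar> \<le> L * \<bar>s - s'\<bar>"
    using lipschitz_in_space by blast
  have lip1: "U (1, t) - L * (1 - s) \<le> U (s, t)" "U (s, t) \<le> U (1, t) + L * (1 - s)"
    if "s \<in> {0..1}" "\<bar>t - t0\<bar> < r" for s t
    using lip[of 1 s t] that by (auto simp: abs_le_iff)
  obtain \<rho> where \<rho>: "\<rho> > 0"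
    and h_close: "\<And>s s' p p'. s \<in> {0..1} \<Longrightarrow> s' \<in> {0..1} \<Longrightarrow> \<bar>p\<bar> \<le> L + 15 \<Longrightarrow> \<bar>p'\<bar> \<le> L + 15 \<Longrightarrow>
      \<bar>s - s'\<bar> < \<rho> \<Longrightarrow> \<bar>p - p'\<bar> < \<rho> \<Longrightarrow> \<bar>h s p - h s' p'\<bar> < \<eta> / 2"
    using h_uniformly_continuous[of "\<eta> / 2" "L + 15"] eta_pos by (metis half_gt_zero)
  \<comment> \<open>The interior slope found below is within \<open>12 * \<epsilon>\<close> of
    \<open>p\<close>, and it is compared with \<open>p + 2 * \<epsilon>\<close>. The total
    \<open>14 * \<epsilon>\<close> has to be strictly less than \<open>\<rho>\<close>.\<close>
  define \<epsilon> where "\<epsilon> = min 1 (\<rho> / 15)"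
  have eps: "\<epsilon> > 0" "\<epsilon> \<le> 1" "15 * \<epsilon> \<le> \<rho>" using \<rho> by (auto simp: \<epsilon>_def)
  obtain C d0 where d0: "d0 > 0" "d0 < 1" and C: "C \<ge> 0"
    and expand: "\<And>s t. s \<in> {1 - d0..1} \<Longrightarrow> \<bar>t - t0\<bar> \<le> r / 4 \<Longrightarrow>
      \<bar>U (s, t) - U (s, t0) - q * (t - t0)\<bar> \<le> \<epsilon> * (1 - s) + C * (t - t0)\<^sup>2"
    by (rule time_expansion_near_end[OF U_end eps(1)]) (assumption, rule that)
  \<comment> \<open>\<open>S\<close> contains the slopes of lines through the end value that stay
    below \<open>U (\<cdot>, t0)\<close> on some left neighbourhood of \<open>1\<close>. As
    \<open>1 - s\<close> is nonnegative, a larger slope gives a lower line, so the infimum is the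
    limit superior of the backward quotients; the Lipschitz bound makes it finite.\<close>
  define S where "S = {K. \<exists>d\<in>{0<..1}. \<forall>s\<in>{1 - d..1}. U (1, t0) - K * (1 - s) \<le> U (s, t0)}"
  define p where "p = Inf S"
  have L_S: "L \<in> S"
  proof -
    have "\<forall>s\<in>{1 - 1..1}. U (1, t0) - L * (1 - s) \<le> U (s, t0)" using lip1(1)[of _ t0] r_pos by simp
    then show ?thesis unfolding S_def by (intro CollectI bexI[of _ 1]) simp_all
  qed
  have S_ge: "- L \<le> K" if K: "K \<in> S" for K
  proof -
    obtain d where d: "d \<in> {0<..1}" and "\<forall>s\<in>{1 - d..1}. U (1, t0) - K * (1 - s) \<le> U (s, t0)"
      using K unfolding S_def by blast
    moreover have "1 - d \<in> {1 - d..1}" using d by auto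
    ultimately have "U (1, t0) - K * (1 - (1 - d)) \<le> U (1 - d, t0)" by blast
    then have "U (1, t0) - K * d \<le> U (1 - d, t0)" by simp
    also have "\<dots> \<le> U (1, t0) + L * d" using lip1(2)[of "1 - d" t0] d r_pos by auto
    finally have "(- L) * d \<le> K * d" by simp
    then show ?thesis using d by (simp only: mult_le_cancel_right) auto
  qed
  have bdd: "bdd_below S" using S_ge by (rule bdd_belowI)
  have p_le: "p \<le> L" unfolding p_def by (rule cInf_lower[OF L_S bdd])
  have p_ge: "- L \<le> p" unfolding p_def using L_S S_ge by (intro cInf_greatest) auto
  obtain d1 where d1: "d1 \<in> {0<..1}"
    and below: "\<And>s. s \<in> {1 - d1..1} \<Longrightarrow> U (1, t0) - (p + \<epsilon>) * (1 - s) \<le> U (s, t0)"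
  proof -
    have "Inf S < p + \<epsilon>" using eps by (simp add: p_def)
    then obtain K where K: "K \<in> S" "K < p + \<epsilon>" using L_S bdd by (subst (asm) cInf_less_iff) auto
    then obtain d where d: "d \<in> {0<..1}" "\<And>s. s \<in> {1 - d..1} \<Longrightarrow> U (1, t0) - K * (1 - s) \<le> U (s, t0)"
      unfolding S_def by blast
    show thesis
    proof (rule that[OF d(1)])
      fix s assume s: "s \<in> {1 - d..1}"
      then have "K * (1 - s) \<le> (p + \<epsilon>) * (1 - s)" using K by (intro mult_right_mono) auto
      then show "U (1, t0) - (p + \<epsilon>) * (1 - s) \<le> U (s, t0)" using d(2)[OF s] by linarith
    qed
  qed
  \<comment> \<open>One \<open>\<epsilon>\<close> comes from approximating the infimum, the other
    absorbs the error \<open>\<epsilon> * (1 - s)\<close> of the time expansion.\<close>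
  have "superjet ({0..1} \<times> UNIV) (\<lambda>z. - U z) (1, t0) (- (p + 2 * \<epsilon>), - q)"
  proof (rule superjet_pairI[where r = "Min {d0, d1, r / 4}" and C = C])
    fix s t assume st: "(s, t) \<in> {0..1} \<times> (UNIV :: real set)" "\<bar>s - 1\<bar> < Min {d0, d1, r / 4}" "\<bar>t - t0\<bar> < Min {d0, d1, r / 4}"
    then have s: "s \<in> {1 - d0..1}" "s \<in> {1 - d1..1}" and t: "\<bar>t - t0\<bar> \<le> r / 4" by auto
    have "C * (s - 1)\<^sup>2 \<ge> 0" using C by simp
    then show "- U (s, t) \<le> - U (1, t0) + - (p + 2 * \<epsilon>) * (s - 1) + - q * (t - t0) + C * ((s - 1)\<^sup>2 + (t - t0)\<^sup>2)"
      using below[OF s(2)] expand[OF s(1) t] by (simp add: abs_le_iff algebra_simps)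
  qed (use d0 d1 r_pos in auto)
  then have super: "0 \<le> q + h 1 (p + 2 * \<epsilon>)" by (rule end_super)
  \<comment> \<open>\<open>C\<close> and \<open>c\<close> compensate the time errors at
    \<open>s1\<close> and at the end \<open>1\<close>; the remaining \<open>1\<close> leaves a
    surplus \<open>(t - t0)\<^sup>2\<close> to exclude the time edges.\<close>
  define M where "M = C + c + 1"
  have M: "M > 0" using C c_nonneg by (simp add: M_def)
  \<comment> \<open>This keeps the time slope \<open>2 * M * (t - t0)\<close> of the test function
    within \<open>\<eta> / 8\<close>.\<close>
  define r' where "r' = min (r / 4) (\<eta> / (16 * M))"
  have r': "r' > 0" "r' \<le> r / 4" "16 * M * r' \<le> \<eta>"
  proof -
    show "r' > 0" "r' \<le> r / 4" using r_pos M eta_pos by (auto simp: r'_def)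
    have "r' \<le> \<eta> / (16 * M)" unfolding r'_def by (rule min.cobounded2)
    then show "16 * M * r' \<le> \<eta>" using M by (simp add: pos_le_divide_eq mult.commute)
  qed
  \<comment> \<open>The last entry makes the box so short in space that the growth of
    \<open>U\<close>, of the line and of the bump together stays below the surplus
    \<open>r'\<^sup>2\<close> on the time edges.\<close>
  define d where "d = Min {d0, d1, \<rho> / 2, r'\<^sup>2 / (2 * (2 * L + 12 * \<epsilon>))}"
  have pos: "2 * L + 12 * \<epsilon> > 0" using L eps by simp
  have d: "d > 0" "d \<le> d0" "d \<le> d1" "d < \<rho>" "(2 * L + 12 * \<epsilon>) * d < r'\<^sup>2"
  proof -
    show "d > 0" "d \<le> d0" "d \<le> d1" using d0 d1 \<rho> r' pos by (auto simp: d_def)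
    have "d \<le> \<rho> / 2" unfolding d_def by (intro Min_le) auto
    then show "d < \<rho>" using \<rho> by simp
    have "d \<le> r'\<^sup>2 / (2 * (2 * L + 12 * \<epsilon>))" unfolding d_def by (intro Min_le) auto
    then have "d * (2 * (2 * L + 12 * \<epsilon>)) \<le> r'\<^sup>2" using pos by (subst (asm) pos_le_divide_eq) auto
    moreover have "r'\<^sup>2 > 0" using r' by simp
    moreover have "d * (2 * (2 * L + 12 * \<epsilon>)) = 2 * ((2 * L + 12 * \<epsilon>) * d)" by (simp only: ac_simps)
    ultimately show "(2 * L + 12 * \<epsilon>) * d < r'\<^sup>2" by linarith
  qed
  have "p - \<epsilon> \<notin> S" using cInf_lower[OF _ bdd, of "p - \<epsilon>"] eps by (auto simp: p_def)
  then obtain s1 where s1: "s1 \<in> {1 - d..1}" and s1_low: "U (s1, t0) < U (1, t0) - (p - \<epsilon>) * (1 - s1)"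
  proof -
    have "\<not> (\<forall>s\<in>{1 - d..1}. U (1, t0) - (p - \<epsilon>) * (1 - s) \<le> U (s, t0))"
    proof
      assume "\<forall>s\<in>{1 - d..1}. U (1, t0) - (p - \<epsilon>) * (1 - s) \<le> U (s, t0)"
      moreover have "d \<in> {0<..1}" using d d0 by auto
      ultimately have "p - \<epsilon> \<in> S" unfolding S_def by (intro CollectI bexI[of _ d])
      with \<open>p - \<epsilon> \<notin> S\<close> show False by simp
    qed
    then show ?thesis using that by (auto simp: not_le)
  qed
  have "s1 \<noteq> 1" using s1_low by auto
  define d2 where "d2 = 1 - s1"
  have d2: "d2 > 0" "d2 \<le> d" "s1 = 1 - d2" using s1 \<open>s1 \<noteq> 1\<close> by (auto simp: d2_def)
  \<comment> \<open>The bump \<open>k * (s - s1) * (1 - s)\<close> vanishes at both ends and equals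
    \<open>3 * \<epsilon> * d2\<close> at the midpoint, where \<open>U\<close> falls below the line
    of slope \<open>p\<close> by at most \<open>\<epsilon> * d2 / 2\<close>. The excess
    \<open>5 / 2 * \<epsilon> * d2\<close> beats the value at \<open>s1\<close>, which is below
    \<open>2 * \<epsilon> * d2\<close> (one part from the chord, one from the time expansion), and
    the value at \<open>1\<close>, which is at most zero.\<close>
  define k where "k = 12 * \<epsilon> / d2"
  have k: "k > 0" "k * d2 = 12 * \<epsilon>" using eps d2 by (auto simp: k_def)
  define P where "P s t = U (1, t0) + q * (t - t0) - p * (1 - s) - k * ((s - s1) * (1 - s)) + M * (t - t0)\<^sup>2" for s t
  let ?K = "{s1..1} \<times> {t0 - r'..t0 + r'}"
  have sub: "?K \<subseteq> {0..1} \<times> {t0 - r..t0 + r}" using d2 d d0 r' r_pos by auto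
  have "continuous_on ?K (\<lambda>z. U z - P (fst z) (snd z))"
    unfolding P_def by (intro continuous_intros continuous_on_subset[OF U_cont sub])
  moreover have "compact ?K" by (intro compact_Times compact_Icc)
  moreover have "?K \<noteq> {}" using r' d2 by auto
  ultimately obtain z where z: "z \<in> ?K" and z_max: "\<And>y. y \<in> ?K \<Longrightarrow> U y - P (fst y) (snd y) \<le> U z - P (fst z) (snd z)"
    using continuous_attains_sup[of ?K "\<lambda>z. U z - P (fst z) (snd z)"] by blast
  obtain s t where z_eq: "z = (s, t)" by (cases z)
  have st: "s1 \<le> s" "s \<le> 1" "\<bar>t - t0\<bar> \<le> r'" using z z_eq by (auto simp: abs_le_iff)
  have s01: "s \<in> {0..1}" and tr: "\<bar>t - t0\<bar> < r" "\<bar>t - t0\<bar> \<le> r / 4" using st d2 d d0 r' r_pos by auto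
  have low: "5 / 2 * \<epsilon> * d2 \<le> U (s, t) - P s t"
  proof -
    define m where "m = (1 + s1) / 2"
    have m: "1 - m = d2 / 2" "m - s1 = d2 / 2" by (auto simp: m_def d2_def field_simps)
    have "m \<in> {1 - d1..1}" using m d2 d by auto
    then have "U (1, t0) - (p + \<epsilon>) * (d2 / 2) \<le> U (m, t0)" using below[of m] m by simp
    moreover have "P m t0 = U (1, t0) - p * (d2 / 2) - (k * d2) * d2 / 4" by (simp add: P_def m)
    then have "P m t0 = U (1, t0) - p * (d2 / 2) - 3 * \<epsilon> * d2" by (simp add: k)
    moreover have "U (m, t0) - P m t0 \<le> U (s, t) - P s t"
      using z_max[of "(m, t0)"] z_eq m d2 r' by auto
    ultimately show ?thesis by (simp add: algebra_simps add_divide_distrib)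
  qed
  have pos2: "5 / 2 * \<epsilon> * d2 > 2 * \<epsilon> * d2" "2 * \<epsilon> * d2 > 0" using eps d2 by auto
  have cM: "c * (t - t0)\<^sup>2 - M * (t - t0)\<^sup>2 \<le> - (t - t0)\<^sup>2" "C * (t - t0)\<^sup>2 - M * (t - t0)\<^sup>2 \<le> 0"
    using mult_nonneg_nonneg[OF C zero_le_power2[of "t - t0"]] mult_nonneg_nonneg[OF c_nonneg zero_le_power2[of "t - t0"]]
      zero_le_power2[of "t - t0"] unfolding M_def distrib_right by linarith+
  have "s \<noteq> 1"
  proof
    assume "s = 1"
    then have "U (s, t) - P s t \<le> c * (t - t0)\<^sup>2 - M * (t - t0)\<^sup>2"
      using U_end[of t] tr by (simp add: P_def)
    then have "U (s, t) - P s t \<le> 0" using cM by (smt (verit) zero_le_power2)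
    then show False using low pos2 by linarith
  qed
  moreover have "s \<noteq> s1"
  proof
    assume s: "s = s1"
    have "U (s1, t) \<le> U (s1, t0) + q * (t - t0) + \<epsilon> * d2 + C * (t - t0)\<^sup>2"
      using expand[of s1 t] s1 d tr by (auto simp: abs_le_iff d2_def)
    moreover have "U (s1, t0) < U (1, t0) - (p - \<epsilon>) * d2" using s1_low by (simp add: d2_def)
    ultimately have "U (s, t) - P s t < 2 * \<epsilon> * d2 + (C * (t - t0)\<^sup>2 - M * (t - t0)\<^sup>2)"
      by (simp add: P_def s d2_def algebra_simps)
    then show False using low pos2 cM by linarith
  qed
  moreover have "\<bar>t - t0\<bar> \<noteq> r'"
  proof
    assume "\<bar>t - t0\<bar> = r'"
    then have sq: "(t - t0)\<^sup>2 = r'\<^sup>2" by (metis power2_abs)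
    have "U (s, t) \<le> U (1, t) + L * (1 - s)" using lip1(2)[OF s01 tr(1)] .
    moreover have "U (1, t) \<le> U (1, t0) + q * (t - t0) + c * (t - t0)\<^sup>2" using U_end tr by simp
    moreover have "p * (1 - s) \<le> L * (1 - s)" using p_le st by (intro mult_right_mono) auto
    moreover have "k * ((s - s1) * (1 - s)) \<le> k * (d2 * (1 - s))"
      using st d2 k by (intro mult_left_mono mult_right_mono) auto
    then have "k * ((s - s1) * (1 - s)) \<le> 12 * \<epsilon> * (1 - s)" by (simp add: k(2)[symmetric])
    moreover have "(2 * L + 12 * \<epsilon>) * (1 - s) \<le> (2 * L + 12 * \<epsilon>) * d"
      using st d2 pos by (intro mult_left_mono) auto
    ultimately have "U (s, t) - P s t \<le> r'\<^sup>2 + (c * (t - t0)\<^sup>2 - M * (t - t0)\<^sup>2)"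
      using d(5) by (simp add: P_def algebra_simps)
    then show False using low pos2 cM sq by linarith
  qed
  ultimately have inner: "s \<in> {s1<..<1}" "t \<in> {t0 - r'<..<t0 + r'}" using st by auto
  define p' where "p' = p - k * ((1 - s) - (s - s1))"
  have jet: "superjet UNIV U (s, t) (p', q + 2 * M * (t - t0))"
  proof (rule superjet_boxI[OF inner, where C = "k + M"])
    fix x y :: real assume xy: "x \<in> {s1..1}" "y \<in> {t0 - r'..t0 + r'}"
    have "U (x, y) \<le> U (s, t) + (P x y - P s t)"
      using z_max[of "(x, y)"] xy z_eq by auto
    also have "P x y - P s t = p' * (x - s) + (q + 2 * M * (t - t0)) * (y - t)
        + (k * (x - s)\<^sup>2 + M * (y - t)\<^sup>2)"
      by (simp add: P_def p'_def power2_eq_square algebra_simps)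
    also have "k * (x - s)\<^sup>2 + M * (y - t)\<^sup>2 \<le> (k + M) * ((x - s)\<^sup>2 + (y - t)\<^sup>2)"
      using M k by (simp add: distrib_left distrib_right)
    finally show "U (x, y) \<le> U (s, t) + p' * (x - s) + (q + 2 * M * (t - t0)) * (y - t)
        + (k + M) * ((x - s)\<^sup>2 + (y - t)\<^sup>2)" by simp
  qed
  have "s \<in> {0<..<1}" using inner d2 d d0 by auto
  from U_sub[OF this tr(1) jet] have sub_ineq: "q + 2 * M * (t - t0) + h s p' \<le> - \<eta>" .
  have "k * \<bar>(1 - s) - (s - s1)\<bar> \<le> k * d2" using inner d2 k by (intro mult_left_mono) auto
  then have p': "\<bar>p' - p\<bar> \<le> 12 * \<epsilon>" using k by (simp add: p'_def abs_mult)
  have "\<bar>h s p' - h 1 (p + 2 * \<epsilon>)\<bar> < \<eta> / 2"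
  proof (rule h_close)
    show "\<bar>p' - (p + 2 * \<epsilon>)\<bar> < \<rho>" using p' eps by linarith
    show "\<bar>p'\<bar> \<le> L + 15" "\<bar>p + 2 * \<epsilon>\<bar> \<le> L + 15" using p' eps p_le p_ge by linarith+
    show "\<bar>s - 1\<bar> < \<rho>" using st d2 d by auto
  qed (use s01 in auto)
  moreover have "16 * \<bar>M * (t - t0)\<bar> \<le> \<eta>"
  proof -
    have "M * \<bar>t - t0\<bar> \<le> M * r'" using st M by (intro mult_left_mono) auto
    moreover have "\<bar>M * (t - t0)\<bar> = M * \<bar>t - t0\<bar>" using M by (simp add: abs_mult)
    ultimately show ?thesis using r'(3) by linarith
  qed
  ultimately show False using sub_ineq super eta_pos by (simp add: abs_le_iff abs_less_iff)
qed

end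

section \<open>Sup-convolution in time\<close>

text \<open>The supremum is over a fixed compact interval, so it is attained for continuous
  \<open>w\<close>. Applied to \<open>- v\<close> this is minus the inf-convolution of
  \<open>v\<close>, so one theory serves both functions; the space type is left open to cover the
  network and the parameter of an arc alike.\<close>

definition sup_conv :: "real \<Rightarrow> real \<Rightarrow> real \<Rightarrow> ('b \<times> real \<Rightarrow> real) \<Rightarrow> 'b \<times> real \<Rightarrow> real" where
  "sup_conv k a b w = (\<lambda>(x, t). SUP \<tau>\<in>{a..b}. w (x, \<tau>) - k * (t - \<tau>)\<^sup>2)"

definition sup_conv_argmax :: "real \<Rightarrow> real \<Rightarrow> real \<Rightarrow> ('b \<times> real \<Rightarrow> real) \<Rightarrow> 'b \<Rightarrow> real \<Rightarrow> real \<Rightarrow> bool" where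
  "sup_conv_argmax k a b w x t \<tau> \<longleftrightarrow> \<tau> \<in> {a..b} \<and>
     (\<forall>\<tau>'\<in>{a..b}. w (x, \<tau>') - k * (t - \<tau>')\<^sup>2 \<le> w (x, \<tau>) - k * (t - \<tau>)\<^sup>2)"

lemma sup_conv_along: "along (sup_conv k a b w) \<gamma> = sup_conv k a b (along w \<gamma>)"
  by (auto simp: along_def sup_conv_def)

lemma sup_conv_argmax_along: "sup_conv_argmax k a b (along w \<gamma>) s t \<tau> \<longleftrightarrow> sup_conv_argmax k a b w (\<gamma> s) t \<tau>"
  by (simp add: along_def sup_conv_argmax_def)

lemma sup_conv_eq:
  assumes "sup_conv_argmax k a b w x t \<tau>"
  shows "sup_conv k a b w (x, t) = w (x, \<tau>) - k * (t - \<tau>)\<^sup>2"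
  using assms unfolding sup_conv_def sup_conv_argmax_def by (auto intro!: cSup_eq_maximum)

lemma sup_conv_argmax_exists:
  assumes "continuous_on {a..b} (\<lambda>\<tau>. w (x, \<tau>))" and "a \<le> b"
  obtains \<tau> where "sup_conv_argmax k a b w x t \<tau>"
proof -
  have "continuous_on {a..b} (\<lambda>\<tau>. w (x, \<tau>) - k * (t - \<tau>)\<^sup>2)"
    by (intro continuous_intros assms(1))
  moreover have "{a..b} \<noteq> {}" using assms(2) by simp
  ultimately obtain \<tau> where "\<tau> \<in> {a..b}"
    "\<forall>\<tau>'\<in>{a..b}. w (x, \<tau>') - k * (t - \<tau>')\<^sup>2 \<le> w (x, \<tau>) - k * (t - \<tau>)\<^sup>2"
    using continuous_attains_sup[OF compact_Icc] by blast
  then show thesis by (intro that) (auto simp: sup_conv_argmax_def)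
qed

lemma le_sup_conv:
  assumes "continuous_on {a..b} (\<lambda>\<tau>. w (x, \<tau>))" and "\<tau> \<in> {a..b}"
  shows "w (x, \<tau>) - k * (t - \<tau>)\<^sup>2 \<le> sup_conv k a b w (x, t)"
proof -
  obtain \<tau>' where "sup_conv_argmax k a b w x t \<tau>'"
    by (rule sup_conv_argmax_exists[OF assms(1)]) (use assms(2) in auto)
  then show ?thesis using assms(2) sup_conv_eq unfolding sup_conv_argmax_def by metis
qed

text \<open>The maximizer for \<open>t\<close> remains a competitor at every other
  \<open>t'\<close>. Its parabola lies below the convolution, touches it at \<open>t\<close>, and
  has slope \<open>2 * k * (\<tau> - t)\<close> there.\<close>

lemma sup_conv_semiconvex:
  assumes "continuous_on {a..b} (\<lambda>\<tau>. w (x, \<tau>))" and "sup_conv_argmax k a b w x t \<tau>"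
  shows "sup_conv k a b w (x, t) + 2 * k * (\<tau> - t) * (t' - t) - k * (t' - t)\<^sup>2 \<le> sup_conv k a b w (x, t')"
proof -
  have "w (x, \<tau>) - k * (t' - \<tau>)\<^sup>2 \<le> sup_conv k a b w (x, t')"
    using assms(2) by (intro le_sup_conv[OF assms(1)]) (simp add: sup_conv_argmax_def)
  then show ?thesis unfolding sup_conv_eq[OF assms(2)] by (simp add: power2_eq_square algebra_simps)
qed

text \<open>Comparing with the competitor \<open>t\<close> itself, the penalty of the maximizer is
  at most the oscillation \<open>2 * M\<close>.\<close>

lemma sup_conv_argmax_near:
  assumes "sup_conv_argmax k a b w x t \<tau>" and "t \<in> {a..b}"
    and "\<And>\<tau>. \<tau> \<in> {a..b} \<Longrightarrow> \<bar>w (x, \<tau>)\<bar> \<le> M" and "2 * M < k * d\<^sup>2" and "d > 0" and "k > 0"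
  shows "\<bar>\<tau> - t\<bar> < d"
proof -
  have \<tau>: "\<tau> \<in> {a..b}" and "w (x, t) - k * (t - t)\<^sup>2 \<le> w (x, \<tau>) - k * (t - \<tau>)\<^sup>2"
    using assms(1,2) unfolding sup_conv_argmax_def by blast+
  then have "k * (t - \<tau>)\<^sup>2 \<le> 2 * M" using assms(3)[OF \<tau>] assms(3)[OF assms(2)] by (simp add: abs_le_iff)
  then have "k * (t - \<tau>)\<^sup>2 < k * d\<^sup>2" using assms(4) by linarith
  then have "(\<tau> - t)\<^sup>2 < d\<^sup>2" using assms(6) by (simp add: power2_commute)
  then show ?thesis using assms(5) by (metis abs_less_iff abs_of_pos power2_less_imp_less power2_abs abs_ge_zero)
qed

text \<open>Moving the competitor by the same amount as the time variable keeps the penalty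
  constant, so increments of \<open>w\<close> around \<open>(s, \<tau>)\<close> are dominated by
  those of the convolution around \<open>(s, t)\<close>. The jet is unchanged and only its time
  moves.\<close>

lemma superjet_of_sup_conv:
  fixes w :: "'b::real_inner \<times> real \<Rightarrow> real"
  assumes "\<And>s. s \<in> X \<Longrightarrow> continuous_on {a..b} (\<lambda>\<tau>. w (s, \<tau>))"
    and arg: "sup_conv_argmax k a b w s t \<tau>" and \<tau>: "\<tau> \<in> {a<..<b}"
    and jet: "superjet (X \<times> UNIV) (sup_conv k a b w) (s, t) (p, q)"
  shows "superjet (X \<times> UNIV) w (s, \<tau>) (p, q)"
proof -
  have "superjet ((\<lambda>y. y + (0, \<tau> - t)) ` (X \<times> UNIV)) w ((s, t) + (0, \<tau> - t)) (p, q)"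
  proof (rule superjet_transfer[OF jet])
    show "Min {\<tau> - a, b - \<tau>} > 0" using \<tau> by auto
    fix y assume y: "y \<in> X \<times> UNIV" "dist y (s, t) < Min {\<tau> - a, b - \<tau>}"
    obtain s' t' where y_eq: "y = (s', t')" by (cases y)
    have "dist t' t < Min {\<tau> - a, b - \<tau>}"
      using dist_snd_le[of y "(s, t)"] y(2) unfolding y_eq snd_conv by linarith
    then have "t' + (\<tau> - t) \<in> {a..b}" by (auto simp: dist_real_def abs_less_iff)
    then have "w (s', t' + (\<tau> - t)) - k * (t' - (t' + (\<tau> - t)))\<^sup>2 \<le> sup_conv k a b w (s', t')"
      using y(1) y_eq by (intro le_sup_conv assms(1)) auto
    moreover have "(t' - (t' + (\<tau> - t)))\<^sup>2 = (t - \<tau>)\<^sup>2" by simp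
    ultimately show "w (y + (0, \<tau> - t)) - w ((s, t) + (0, \<tau> - t)) \<le> sup_conv k a b w y - sup_conv k a b w (s, t)"
      by (simp add: sup_conv_eq[OF arg] y_eq)
  qed
  moreover have "X \<times> UNIV \<subseteq> (\<lambda>y. y + (0, \<tau> - t)) ` (X \<times> UNIV)"
  proof
    fix y :: "'b \<times> real" assume "y \<in> X \<times> UNIV"
    then show "y \<in> (\<lambda>y. y + (0, \<tau> - t)) ` (X \<times> UNIV)"
      by (intro image_eqI[of _ _ "y - (0, \<tau> - t)"]) (auto simp: mem_Times_iff)
  qed
  ultimately show ?thesis using superjet_subset by fastforce
qed

text \<open>Maximality of \<open>\<tau>\<close> is itself a contact from above by a parabola in
  time. The slope is the one in \<open>sup_conv_semiconvex\<close>, which links the vertex condition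
  on \<open>w\<close> to the time slope of its convolution.\<close>

lemma superjet_time_of_sup_conv_argmax:
  assumes "sup_conv_argmax k a b w x t \<tau>" and "\<tau> \<in> {a<..<b}"
  shows "superjet UNIV (\<lambda>t. w (x, t)) \<tau> (2 * k * (\<tau> - t))"
proof (rule superjetI[where C = k])
  show "Min {\<tau> - a, b - \<tau>} > 0" using assms(2) by auto
  fix y assume "dist y \<tau> < Min {\<tau> - a, b - \<tau>}"
  then have "y \<in> {a..b}" by (auto simp: dist_real_def abs_less_iff)
  then have "w (x, y) - k * (t - y)\<^sup>2 \<le> w (x, \<tau>) - k * (t - \<tau>)\<^sup>2"
    using assms(1) unfolding sup_conv_argmax_def by blast
  then show "w (x, y) \<le> w (x, \<tau>) + (2 * k * (\<tau> - t)) \<bullet> (y - \<tau>) + k * (norm (y - \<tau>))\<^sup>2"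
    by (simp add: power2_eq_square algebra_simps)
qed

section \<open>Continuity of the convolution and strict order near a time slice\<close>

lemma continuous_on_time_slice:
  assumes "continuous_on (X \<times> T) w" and "x \<in> X"
  shows "continuous_on T (\<lambda>t. w (x, t))"
  by (rule continuous_on_compose2[OF assms(1)]) (use assms(2) in \<open>auto intro!: continuous_intros\<close>)

lemma continuous_on_sup_conv:
  fixes w :: "'b::metric_space \<times> real \<Rightarrow> real"
  assumes X: "compact X" and w: "continuous_on (X \<times> {a..b}) w" and ab: "a \<le> b"
  shows "continuous_on (X \<times> {a..b}) (sup_conv k a b w)"
proof -
  define G where "G = (\<lambda>z :: ('b \<times> real) \<times> real. w (fst (fst z), snd z) - k * (snd (fst z) - snd z)\<^sup>2)"
  let ?K = "(X \<times> {a..b}) \<times> {a..b}"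
  have "continuous_on ?K G"
    unfolding G_def by (intro continuous_intros continuous_on_compose2[OF w]) auto
  then have unif: "uniformly_continuous_on ?K G"
    by (intro compact_uniformly_continuous compact_Times X compact_Icc)
  have half: "sup_conv k a b w z < sup_conv k a b w z' + e"
    if d: "\<And>y y'. y \<in> ?K \<Longrightarrow> y' \<in> ?K \<Longrightarrow> dist y' y < d \<Longrightarrow> dist (G y') (G y) < e"
      and z: "z \<in> X \<times> {a..b}" "z' \<in> X \<times> {a..b}" "dist z' z < d" for z z' d e
  proof -
    obtain x t x' t' where z_eq: "z = (x, t)" "z' = (x', t')" by (metis surj_pair)
    have x: "x \<in> X" "x' \<in> X" using z z_eq by auto
    obtain \<tau> where \<tau>: "sup_conv_argmax k a b w x t \<tau>"
      by (rule sup_conv_argmax_exists[OF continuous_on_time_slice[OF w x(1)] ab])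
    then have "\<tau> \<in> {a..b}" by (simp add: sup_conv_argmax_def)
    then have "dist (G (z', \<tau>)) (G (z, \<tau>)) < e" using z by (intro d) (auto simp: dist_Pair_Pair)
    moreover have "w (x', \<tau>) - k * (t' - \<tau>)\<^sup>2 \<le> sup_conv k a b w (x', t')"
      by (rule le_sup_conv[OF continuous_on_time_slice[OF w x(2)] \<open>\<tau> \<in> {a..b}\<close>])
    ultimately show ?thesis by (simp add: z_eq sup_conv_eq[OF \<tau>] G_def dist_real_def abs_less_iff)
  qed
  show ?thesis
    unfolding continuous_on_iff
  proof (intro ballI allI impI)
    fix z e assume z: "z \<in> X \<times> {a..b}" and e: "(e :: real) > 0"
    obtain d where d: "d > 0" and *: "\<And>y y'. y \<in> ?K \<Longrightarrow> y' \<in> ?K \<Longrightarrow> dist y' y < d \<Longrightarrow> dist (G y') (G y) < e"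
      using unif e unfolding uniformly_continuous_on_def by metis
    show "\<exists>d>0. \<forall>z'\<in>X \<times> {a..b}. dist z' z < d \<longrightarrow> dist (sup_conv k a b w z') (sup_conv k a b w z) < e"
    proof (intro exI[of _ d] conjI ballI impI d)
      fix z' assume z': "z' \<in> X \<times> {a..b}" "dist z' z < d"
      have "sup_conv k a b w z < sup_conv k a b w z' + e" "sup_conv k a b w z' < sup_conv k a b w z + e"
        using half[OF * z z'(1)] half[OF * z'(1) z] z'(2) by (auto simp: dist_commute)
      then show "dist (sup_conv k a b w z') (sup_conv k a b w z) < e" by (simp add: dist_real_def abs_less_iff)
    qed
  qed
qed

text \<open>The two times are independent because the convolutions of \<open>u\<close> and of
  \<open>- v\<close> have different maximizers over the same point.\<close>

lemma less_near_time_slice: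
  fixes u v :: "'b::metric_space \<times> real \<Rightarrow> real"
  assumes X: "compact X" and u: "continuous_on (X \<times> {a..b}) u" and v: "continuous_on (X \<times> {a..b}) v"
    and e: "e \<in> {a..b}" and less: "\<And>x. x \<in> X \<Longrightarrow> u (x, e) < v (x, e)"
  obtains \<rho> where "\<rho> > 0"
    and "\<And>x \<tau> \<tau>'. x \<in> X \<Longrightarrow> \<tau> \<in> {a..b} \<Longrightarrow> \<tau>' \<in> {a..b} \<Longrightarrow> \<bar>\<tau> - e\<bar> < \<rho> \<Longrightarrow> \<bar>\<tau>' - e\<bar> < \<rho> \<Longrightarrow>
      u (x, \<tau>) < v (x, \<tau>')"
proof (cases "X = {}")
  case True
  then show thesis using that[of 1] by simp
next
  case False
  have "continuous_on X (\<lambda>x. v (x, e) - u (x, e))"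
    by (intro continuous_intros continuous_on_compose2[OF u] continuous_on_compose2[OF v]) (use e in auto)
  then obtain x0 where x0: "x0 \<in> X" "\<And>x. x \<in> X \<Longrightarrow> v (x0, e) - u (x0, e) \<le> v (x, e) - u (x, e)"
    using continuous_attains_inf[OF X False] by blast
  define \<delta> where "\<delta> = (v (x0, e) - u (x0, e)) / 2"
  have \<delta>: "\<delta> > 0" using less[OF x0(1)] by (simp add: \<delta>_def)
  have K: "compact (X \<times> {a..b})" by (intro compact_Times X compact_Icc)
  obtain d where d: "d > 0" and d_u: "\<And>z z'. z \<in> X \<times> {a..b} \<Longrightarrow> z' \<in> X \<times> {a..b} \<Longrightarrow> dist z' z < d \<Longrightarrow> dist (u z') (u z) < \<delta>"
    using compact_uniformly_continuous[OF u K] \<delta> unfolding uniformly_continuous_on_def by metis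
  obtain d' where d': "d' > 0" and d_v: "\<And>z z'. z \<in> X \<times> {a..b} \<Longrightarrow> z' \<in> X \<times> {a..b} \<Longrightarrow> dist z' z < d' \<Longrightarrow> dist (v z') (v z) < \<delta>"
    using compact_uniformly_continuous[OF v K] \<delta> unfolding uniformly_continuous_on_def by metis
  show thesis
  proof (rule that[of "min d d'"])
    fix x \<tau> \<tau>' assume x: "x \<in> X" and \<tau>: "\<tau> \<in> {a..b}" "\<tau>' \<in> {a..b}" "\<bar>\<tau> - e\<bar> < min d d'" "\<bar>\<tau>' - e\<bar> < min d d'"
    have "dist (u (x, \<tau>)) (u (x, e)) < \<delta>" using x \<tau> e by (intro d_u) (auto simp: dist_Pair_Pair dist_real_def)
    moreover have "dist (v (x, \<tau>')) (v (x, e)) < \<delta>" using x \<tau> e by (intro d_v) (auto simp: dist_Pair_Pair dist_real_def)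
    ultimately have "u (x, \<tau>) < u (x, e) + \<delta>" "v (x, e) - \<delta> < v (x, \<tau>')"
      unfolding dist_real_def by linarith+
    moreover have "2 * \<delta> \<le> v (x, e) - u (x, e)" using x0(2)[OF x] by (simp add: \<delta>_def)
    ultimately show "u (x, \<tau>) < v (x, \<tau>')" by linarith
  qed (use d d' in auto)
qed

section \<open>Comparison with a strict subsolution\<close>

lemma compact_network_points:
  assumes "network E"
  shows "compact (network_points E)"
  using assms unfolding network_def network_points_def
  by (intro compact_UN compact_path_image) (auto simp: simple_path_def)

lemma arc_continuous:
  assumes "network E" and "\<gamma> \<in> E"
  shows "continuous_on {0..1} \<gamma>" and "s \<in> {0..1} \<Longrightarrow> \<gamma> s \<in> network_points E"
  using assms unfolding network_def network_points_def
  by (auto simp: simple_path_def path_def path_image_def intro!: bexI[of _ \<gamma>])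

lemma continuous_on_along:
  assumes "network E" and "\<gamma> \<in> E" and "continuous_on (network_points E \<times> T) w"
  shows "continuous_on ({0..1} \<times> T) (along w \<gamma>)"
  unfolding along_def case_prod_beta
  by (rule continuous_on_compose2[OF assms(3)])
    (auto intro!: continuous_intros continuous_on_compose2[OF arc_continuous(1)[OF assms(1,2)]]
      arc_continuous(2)[OF assms(1,2)])

text \<open>Stating the hypotheses through superjets on a compact time interval separates the
  maximum argument from the test functions and from the time function that produces the margin
  \<open>\<eta>\<close>.\<close>

lemma strict_comparison:
  fixes E :: "(real \<Rightarrow> 'a::euclidean_space) set" and u v :: "'a \<times> real \<Rightarrow> real"
  assumes E: "network E" and H: "network_hamiltonians E H" and ab: "a < b" and eta: "\<eta> > 0"
    and u_cont: "continuous_on (network_points E \<times> {a..b}) u"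
    and v_cont: "continuous_on (network_points E \<times> {a..b}) v"
    and u_arc: "\<And>\<gamma> s t p q. \<gamma> \<in> E \<Longrightarrow> s \<in> {0<..<1} \<Longrightarrow> t \<in> {a<..<b} \<Longrightarrow>
      superjet UNIV (along u \<gamma>) (s, t) (p, q) \<Longrightarrow> q + H \<gamma> s p \<le> - \<eta>"
    and u_vertex: "\<And>x t q. x \<in> network_vertices E \<Longrightarrow> t \<in> {a<..<b} \<Longrightarrow>
      superjet UNIV (\<lambda>t. u (x, t)) t q \<Longrightarrow> q \<le> c x - \<eta>"
    and v_arc: "\<And>\<gamma> s t p q. \<gamma> \<in> E \<Longrightarrow> s \<in> {0<..<1} \<Longrightarrow> t \<in> {a<..<b} \<Longrightarrow>
      superjet UNIV (along (\<lambda>z. - v z) \<gamma>) (s, t) (- p, - q) \<Longrightarrow> 0 \<le> q + H \<gamma> s p"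
    and v_vertex: "\<And>x t q. x \<in> network_vertices E \<Longrightarrow> t \<in> {a<..<b} \<Longrightarrow>
      superjet UNIV (\<lambda>t. - v (x, t)) t (- q) \<Longrightarrow> q < c x \<Longrightarrow>
      \<exists>\<gamma>\<in>arcs_into E x. \<forall>p q. superjet ({0..1} \<times> UNIV) (along (\<lambda>z. - v z) \<gamma>) (1, t) (- p, - q) \<longrightarrow>
        0 \<le> q + H \<gamma> 1 p"
    and less: "\<And>x. x \<in> network_points E \<Longrightarrow> u (x, a) < v (x, a)"
      "\<And>x. x \<in> network_points E \<Longrightarrow> u (x, b) < v (x, b)"
    and x: "x \<in> network_points E" and t: "t \<in> {a..b}"
  shows "u (x, t) \<le> v (x, t)"
proof (rule ccontr)
  assume "\<not> u (x, t) \<le> v (x, t)"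
  then have gt: "u (x, t) > v (x, t)" by simp
  let ?X = "network_points E" and ?v = "\<lambda>z. - v z"
  have X: "compact ?X" by (rule compact_network_points[OF E])
  have K: "compact (?X \<times> {a..b})" by (intro compact_Times X compact_Icc)
  have nv_cont: "continuous_on (?X \<times> {a..b}) ?v" by (intro continuous_intros v_cont)
  note u_slice = continuous_on_time_slice[OF u_cont] and v_slice = continuous_on_time_slice[OF nv_cont]
  obtain \<rho>a where \<rho>a: "\<rho>a > 0" and near_a: "\<And>x \<tau> \<tau>'. x \<in> ?X \<Longrightarrow> \<tau> \<in> {a..b} \<Longrightarrow> \<tau>' \<in> {a..b} \<Longrightarrow>
      \<bar>\<tau> - a\<bar> < \<rho>a \<Longrightarrow> \<bar>\<tau>' - a\<bar> < \<rho>a \<Longrightarrow> u (x, \<tau>) < v (x, \<tau>')"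
    by (rule less_near_time_slice[OF X u_cont v_cont _ less(1)]) (use ab in auto)
  obtain \<rho>b where \<rho>b: "\<rho>b > 0" and near_b: "\<And>x \<tau> \<tau>'. x \<in> ?X \<Longrightarrow> \<tau> \<in> {a..b} \<Longrightarrow> \<tau>' \<in> {a..b} \<Longrightarrow>
      \<bar>\<tau> - b\<bar> < \<rho>b \<Longrightarrow> \<bar>\<tau>' - b\<bar> < \<rho>b \<Longrightarrow> u (x, \<tau>) < v (x, \<tau>')"
    by (rule less_near_time_slice[OF X u_cont v_cont _ less(2)]) (use ab in auto)
  \<comment> \<open>If the maximum were within \<open>2 * r\<close> of an end time, its two
    maximizers would be within \<open>3 * r\<close> of that end. Otherwise the window of radius
    \<open>r\<close> around \<open>t0\<close> and all maximizers belonging to it stay inside the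
    open interval.\<close>
  define r where "r = min \<rho>a \<rho>b / 4"
  have r: "r > 0" "4 * r \<le> \<rho>a" "4 * r \<le> \<rho>b" using \<rho>a \<rho>b by (auto simp: r_def)
  obtain Mu where Mu: "\<And>z. z \<in> ?X \<times> {a..b} \<Longrightarrow> \<bar>u z\<bar> \<le> Mu" using bounded_on_compact[OF K u_cont] by blast
  obtain Mv where Mv: "\<And>z. z \<in> ?X \<times> {a..b} \<Longrightarrow> \<bar>?v z\<bar> \<le> Mv" using bounded_on_compact[OF K nv_cont] by blast
  define M where "M = max Mu Mv"
  have M: "\<bar>u z\<bar> \<le> M" "\<bar>?v z\<bar> \<le> M" if "z \<in> ?X \<times> {a..b}" for z
    using Mu[OF that] Mv[OF that] by (auto simp: M_def)
  have "M \<ge> 0" using M(1)[of "(x, t)"] x t by auto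
  define k where "k = (2 * M + 1) / r\<^sup>2"
  have k: "k > 0" "2 * M < k * r\<^sup>2" using r \<open>M \<ge> 0\<close> by (auto simp: k_def)
  define U where "U = sup_conv k a b u"
  define W where "W = sup_conv k a b ?v"
  have U_cont: "continuous_on (?X \<times> {a..b}) U" and W_cont: "continuous_on (?X \<times> {a..b}) W"
    unfolding U_def W_def using ab by (auto intro!: continuous_on_sup_conv X u_cont nv_cont)
  have argmax_u: "\<exists>\<tau>. sup_conv_argmax k a b u x t \<tau> \<and> \<bar>\<tau> - t\<bar> < r" if x: "x \<in> ?X" and t: "t \<in> {a..b}" for x t
  proof -
    obtain \<tau> where \<tau>: "sup_conv_argmax k a b u x t \<tau>"
      by (rule sup_conv_argmax_exists[OF u_slice[OF x]]) (use ab in auto)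
    then show ?thesis using sup_conv_argmax_near[OF \<tau> t M(1) k(2) r(1) k(1)] x t by auto
  qed
  have argmax_v: "\<exists>\<tau>. sup_conv_argmax k a b ?v x t \<tau> \<and> \<bar>\<tau> - t\<bar> < r" if x: "x \<in> ?X" and t: "t \<in> {a..b}" for x t
  proof -
    obtain \<tau> where \<tau>: "sup_conv_argmax k a b ?v x t \<tau>"
      by (rule sup_conv_argmax_exists[OF v_slice[OF x]]) (use ab in auto)
    then show ?thesis using sup_conv_argmax_near[OF \<tau> t M(2) k(2) r(1) k(1)] x t by auto
  qed
  have "continuous_on (?X \<times> {a..b}) (\<lambda>z. U z + W z)" by (intro continuous_intros U_cont W_cont)
  then obtain z0 where z0: "z0 \<in> ?X \<times> {a..b}" and z0_max: "\<And>z. z \<in> ?X \<times> {a..b} \<Longrightarrow> U z + W z \<le> U z0 + W z0"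
    using continuous_attains_sup[OF K, of "\<lambda>z. U z + W z"] x t by blast
  obtain x0 t0 where z0_eq: "z0 = (x0, t0)" by (cases z0)
  have x0: "x0 \<in> ?X" and t0: "t0 \<in> {a..b}" using z0 z0_eq by auto
  have max: "U (x, t) + W (x, t) \<le> U (x0, t0) + W (x0, t0)" if "x \<in> ?X" "t \<in> {a..b}" for x t
    using z0_max[of "(x, t)"] that z0_eq by auto
  obtain \<tau>u where \<tau>u: "sup_conv_argmax k a b u x0 t0 \<tau>u" "\<bar>\<tau>u - t0\<bar> < r" using argmax_u[OF x0 t0] by blast
  obtain \<tau>v where \<tau>v: "sup_conv_argmax k a b ?v x0 t0 \<tau>v" "\<bar>\<tau>v - t0\<bar> < r" using argmax_v[OF x0 t0] by blast
  have \<tau>_ab: "\<tau>u \<in> {a..b}" "\<tau>v \<in> {a..b}" using \<tau>u(1) \<tau>v(1) by (auto simp: sup_conv_argmax_def)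
  \<comment> \<open>Convolution raises the positive gap at \<open>(x, t)\<close>, the maximum raises
    it again, and dropping the penalties returns to values of \<open>u\<close> and \<open>v\<close>,
    now at different times.\<close>
  have pos: "u (x0, \<tau>u) > v (x0, \<tau>v)"
  proof -
    have "u (x, t) \<le> U (x, t)" "?v (x, t) \<le> W (x, t)"
      using le_sup_conv[of a b u x t k t, OF u_slice[OF x] t] le_sup_conv[of a b ?v x t k t, OF v_slice[OF x] t]
      by (simp_all add: U_def W_def)
    moreover have "U (x0, t0) \<le> u (x0, \<tau>u)" "W (x0, t0) \<le> ?v (x0, \<tau>v)"
      unfolding U_def W_def sup_conv_eq[OF \<tau>u(1)] sup_conv_eq[OF \<tau>v(1)] using k by simp_all
    ultimately show ?thesis using max[OF x t] gt by linarith
  qed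
  have t0_a: "t0 \<ge> a + 2 * r"
  proof (rule ccontr)
    assume "\<not> ?thesis"
    then have "\<bar>\<tau>u - a\<bar> < \<rho>a" "\<bar>\<tau>v - a\<bar> < \<rho>a" using \<tau>u(2) \<tau>v(2) \<tau>_ab r by auto
    then show False using near_a[OF x0 \<tau>_ab] pos by simp
  qed
  have t0_b: "t0 \<le> b - 2 * r"
  proof (rule ccontr)
    assume "\<not> ?thesis"
    then have "\<bar>\<tau>u - b\<bar> < \<rho>b" "\<bar>\<tau>v - b\<bar> < \<rho>b" using \<tau>u(2) \<tau>v(2) \<tau>_ab r by auto
    then show False using near_b[OF x0 \<tau>_ab] pos by simp
  qed
  have inner: "t \<in> {a..b}" "\<And>\<tau>. \<bar>\<tau> - t\<bar> < r \<Longrightarrow> \<tau> \<in> {a<..<b}" if "\<bar>t - t0\<bar> \<le> r" for t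
  proof -
    show "t \<in> {a..b}" using that t0_a t0_b r by auto
    show "\<tau> \<in> {a<..<b}" if \<tau>: "\<bar>\<tau> - t\<bar> < r" for \<tau>
    proof -
      have "a < \<tau>" "\<tau> < b" using \<tau> \<open>\<bar>t - t0\<bar> \<le> r\<close> t0_a t0_b by linarith+
      then show ?thesis by simp
    qed
  qed
  have strip: "{t0 - r..t0 + r} \<subseteq> {a..b}" using t0_a t0_b r by auto
  have semi: "\<exists>q. \<bar>q\<bar> \<le> 2 * k * r \<and> (\<forall>t'. sup_conv k a b w (x, t) + q * (t' - t) - k * (t' - t)\<^sup>2 \<le> sup_conv k a b w (x, t'))"
    if "continuous_on {a..b} (\<lambda>\<tau>. w (x, \<tau>))" "sup_conv_argmax k a b w x t \<tau>" "\<bar>\<tau> - t\<bar> < r"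
    for w :: "'a \<times> real \<Rightarrow> real" and x t \<tau>
  proof (intro exI[of _ "2 * k * (\<tau> - t)"] conjI allI sup_conv_semiconvex that(1,2))
    have "2 * k * \<bar>\<tau> - t\<bar> \<le> 2 * k * r" using that(3) k by (intro mult_left_mono) auto
    then show "\<bar>2 * k * (\<tau> - t)\<bar> \<le> 2 * k * r" using k by (simp add: abs_mult)
  qed
  have arc: "regularized_subsolution (H \<gamma>) (along U \<gamma>) t0 r (2 * k * r) k \<eta>" if \<gamma>: "\<gamma> \<in> E" for \<gamma>
  proof
    show "continuous_on ({0..1} \<times> UNIV) (\<lambda>(s, p). H \<gamma> s p)"
      "\<And>K. \<exists>R. \<forall>s\<in>{0..1}. \<forall>p. R \<le> \<bar>p\<bar> \<longrightarrow> K \<le> H \<gamma> s p"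
      using H \<gamma> unfolding network_hamiltonians_def by blast+
    show "r > 0" "\<eta> > 0" "k \<ge> 0" using r eta k by auto
    show "continuous_on ({0..1} \<times> {t0 - r..t0 + r}) (along U \<gamma>)"
      by (rule continuous_on_along[OF E \<gamma>]) (use strip in \<open>auto intro: continuous_on_subset[OF U_cont]\<close>)
  next
    fix s t :: real assume s: "s \<in> {0..1}" and t: "\<bar>t - t0\<bar> \<le> r"
    have x: "\<gamma> s \<in> ?X" by (rule arc_continuous(2)[OF E \<gamma> s])
    obtain \<tau> where "sup_conv_argmax k a b u (\<gamma> s) t \<tau>" "\<bar>\<tau> - t\<bar> < r"
      using argmax_u[OF x inner(1)[OF t]] by blast
    from semi[OF u_slice[OF x] this]
    show "\<exists>q. \<bar>q\<bar> \<le> 2 * k * r \<and> (\<forall>t'. \<bar>t' - t0\<bar> \<le> r \<longrightarrow>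
        along U \<gamma> (s, t) + q * (t' - t) - k * (t' - t)\<^sup>2 \<le> along U \<gamma> (s, t'))"
      by (auto simp: along_def U_def)
  next
    fix s t p q :: real
    assume s: "s \<in> {0<..<1}" and t: "\<bar>t - t0\<bar> < r" and jet: "superjet UNIV (along U \<gamma>) (s, t) (p, q)"
    have s01: "s \<in> {0..1}" using s by auto
    obtain \<tau> where \<tau>: "sup_conv_argmax k a b u (\<gamma> s) t \<tau>" "\<bar>\<tau> - t\<bar> < r"
      using argmax_u[OF arc_continuous(2)[OF E \<gamma> s01] inner(1)[OF less_imp_le[OF t]]] by blast
    have \<tau>_in: "\<tau> \<in> {a<..<b}" using inner(2)[OF less_imp_le[OF t] \<tau>(2)] .
    have "superjet ({0..1} \<times> UNIV) (along u \<gamma>) (s, \<tau>) (p, q)"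
    proof (rule superjet_of_sup_conv[OF _ _ \<tau>_in])
      show "continuous_on {a..b} (\<lambda>\<tau>. along u \<gamma> (s, \<tau>))" if "s \<in> {0..1}" for s
        using u_slice[OF arc_continuous(2)[OF E \<gamma> that]] by (simp add: along_def)
      show "sup_conv_argmax k a b (along u \<gamma>) s t \<tau>" using \<tau> by (simp add: sup_conv_argmax_along)
      show "superjet ({0..1} \<times> UNIV) (sup_conv k a b (along u \<gamma>)) (s, t) (p, q)"
        using superjet_subset[OF jet] by (simp add: U_def sup_conv_along)
    qed
    then show "q + H \<gamma> s p \<le> - \<eta>" using u_arc[OF \<gamma> s \<tau>_in] superjet_UNIV_of_strip s by blast
  qed
  have jet_v: "superjet ({0..1} \<times> UNIV) (along ?v \<gamma>) (s, \<tau>) (p, q)"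
    if \<gamma>: "\<gamma> \<in> E" and \<tau>: "sup_conv_argmax k a b ?v (\<gamma> s) t \<tau>" "\<tau> \<in> {a<..<b}"
      and jet: "superjet ({0..1} \<times> UNIV) (along W \<gamma>) (s, t) (p, q)" for \<gamma> s t \<tau> p q
  proof (rule superjet_of_sup_conv[OF _ _ \<tau>(2)])
    show "continuous_on {a..b} (\<lambda>\<tau>. along ?v \<gamma> (s, \<tau>))" if "s \<in> {0..1}" for s
      using v_slice[OF arc_continuous(2)[OF E \<gamma> that]] by (simp add: along_def)
    show "sup_conv_argmax k a b (along ?v \<gamma>) s t \<tau>" using \<tau> by (simp add: sup_conv_argmax_along)
    show "superjet ({0..1} \<times> UNIV) (sup_conv k a b (along ?v \<gamma>)) (s, t) (p, q)"
      using jet by (simp add: W_def sup_conv_along)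
  qed
  show False
  proof (cases "x0 \<in> network_vertices E")
    case False
    obtain \<gamma> s0 where \<gamma>: "\<gamma> \<in> E" and s0: "s0 \<in> {0..1}" and x0_eq: "x0 = \<gamma> s0"
      using x0 unfolding network_points_def path_image_def by blast
    have "\<gamma> 0 \<in> network_vertices E" "\<gamma> 1 \<in> network_vertices E"
      using \<gamma> unfolding network_vertices_def pathstart_def pathfinish_def by auto
    then have s0': "s0 \<in> {0<..<1}" using s0 False x0_eq by (cases "s0 = 0"; cases "s0 = 1") auto
    interpret regularized_subsolution "H \<gamma>" "along U \<gamma>" t0 r "2 * k * r" k \<eta> by (rule arc[OF \<gamma>])
    show False
    proof (rule no_interior_max[where V = "\<lambda>z. - along W \<gamma> z"])
      show "s0 \<in> {0<..<1}" by (rule s0')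
      show "continuous_on ({0..1} \<times> {t0 - r..t0 + r}) (\<lambda>z. - along W \<gamma> z)"
        by (intro continuous_intros continuous_on_along[OF E \<gamma>])
          (use strip in \<open>auto intro: continuous_on_subset[OF W_cont]\<close>)
    next
      fix s t :: real assume s: "s \<in> {0..1}" and t: "\<bar>t - t0\<bar> \<le> r"
      have x: "\<gamma> s \<in> ?X" by (rule arc_continuous(2)[OF E \<gamma> s])
      obtain \<tau> where "sup_conv_argmax k a b ?v (\<gamma> s) t \<tau>" "\<bar>\<tau> - t\<bar> < r"
        using argmax_v[OF x inner(1)[OF t]] by blast
      from semi[OF v_slice[OF x] this] obtain q
        where q: "\<And>t'. W (\<gamma> s, t) + q * (t' - t) - k * (t' - t)\<^sup>2 \<le> W (\<gamma> s, t')"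
        unfolding W_def by blast
      have "- W (\<gamma> s, t') \<le> - W (\<gamma> s, t) + - q * (t' - t) + k * (t' - t)\<^sup>2" for t'
        using q[of t'] by (simp add: algebra_simps)
      then show "\<exists>q. \<forall>t'. \<bar>t' - t0\<bar> \<le> r \<longrightarrow>
          - along W \<gamma> (s, t') \<le> - along W \<gamma> (s, t) + q * (t' - t) + k * (t' - t)\<^sup>2"
        unfolding along_def case_prod_conv by blast
      show "along U \<gamma> (s, t) - (- along W \<gamma> (s, t)) \<le> along U \<gamma> (s0, t0) - (- along W \<gamma> (s0, t0))"
        using max[OF x inner(1)[OF t]] by (simp add: along_def x0_eq)
    next
      fix s t p q :: real
      assume s: "s \<in> {0<..<1}" and t: "\<bar>t - t0\<bar> < r"
        and jet: "superjet UNIV (\<lambda>z. - (- along W \<gamma> z)) (s, t) (- p, - q)"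
      have s01: "s \<in> {0..1}" using s by auto
      obtain \<tau> where \<tau>: "sup_conv_argmax k a b ?v (\<gamma> s) t \<tau>" "\<bar>\<tau> - t\<bar> < r"
        using argmax_v[OF arc_continuous(2)[OF E \<gamma> s01] inner(1)[OF less_imp_le[OF t]]] by blast
      have \<tau>_in: "\<tau> \<in> {a<..<b}" using inner(2)[OF less_imp_le[OF t] \<tau>(2)] .
      have "superjet ({0..1} \<times> UNIV) (along ?v \<gamma>) (s, \<tau>) (- p, - q)"
        using superjet_subset[OF jet] by (intro jet_v[OF \<gamma> \<tau>(1) \<tau>_in]) simp
      then show "0 \<le> q + H \<gamma> s p" using v_arc[OF \<gamma> s \<tau>_in] superjet_UNIV_of_strip s by blast
    qed
  next
    case True
    define q where "q = 2 * k * (\<tau>u - t0)"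
    define q' where "q' = 2 * k * (\<tau>v - t0)"
    have t0_le: "\<bar>t0 - t0\<bar> \<le> r" using r by simp
    have \<tau>_in: "\<tau>u \<in> {a<..<b}" "\<tau>v \<in> {a<..<b}" using inner(2)[OF t0_le] \<tau>u(2) \<tau>v(2) by blast+
    have low_U: "U (x0, t0) + q * (t - t0) - k * (t - t0)\<^sup>2 \<le> U (x0, t)" for t
      unfolding U_def q_def by (rule sup_conv_semiconvex[OF u_slice[OF x0] \<tau>u(1)])
    have low_W: "W (x0, t0) + q' * (t - t0) - k * (t - t0)\<^sup>2 \<le> W (x0, t)" for t
      unfolding W_def q'_def by (rule sup_conv_semiconvex[OF v_slice[OF x0] \<tau>v(1)])
    \<comment> \<open>At \<open>x0\<close> the two lower parabolas add up to a lower parabola for a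
      function of time with a maximum at \<open>t0\<close>.\<close>
    have "q + q' = 0"
    proof (rule slope_eq_0[OF r(1)])
      fix \<tau> :: real assume "\<bar>\<tau>\<bar> < r"
      then have "U (x0, t0 + \<tau>) + W (x0, t0 + \<tau>) \<le> U (x0, t0) + W (x0, t0)"
        using inner(1)[of "t0 + \<tau>"] by (intro max[OF x0]) auto
      then show "(q + q') * \<tau> \<le> (2 * k) * \<tau>\<^sup>2"
        using low_U[of "t0 + \<tau>"] low_W[of "t0 + \<tau>"] by (simp add: algebra_simps)
    qed
    then have q': "q' = - q" by simp
    have "q \<le> c x0 - \<eta>"
      using superjet_time_of_sup_conv_argmax[OF \<tau>u(1) \<tau>_in(1)] unfolding q_def
      by (intro u_vertex[OF True \<tau>_in(1)])
    then have "q < c x0" using eta by simp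
    moreover have "superjet UNIV (\<lambda>t. - v (x0, t)) \<tau>v (- q)"
      using superjet_time_of_sup_conv_argmax[OF \<tau>v(1) \<tau>_in(2)] by (simp add: q'_def[symmetric] q')
    ultimately obtain \<gamma> where \<gamma>_into: "\<gamma> \<in> arcs_into E x0"
      and vertex: "\<And>p q. superjet ({0..1} \<times> UNIV) (along ?v \<gamma>) (1, \<tau>v) (- p, - q) \<Longrightarrow> 0 \<le> q + H \<gamma> 1 p"
      using v_vertex[OF True \<tau>_in(2)] by blast
    have \<gamma>: "\<gamma> \<in> E" and \<gamma>1: "\<gamma> 1 = x0" using \<gamma>_into by (auto simp: arcs_into_def pathfinish_def)
    interpret regularized_subsolution "H \<gamma>" "along U \<gamma>" t0 r "2 * k * r" k \<eta> by (rule arc[OF \<gamma>])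
    show False
    proof (rule no_end_subjets)
      fix t assume "\<bar>t - t0\<bar> \<le> r"
      then have "U (x0, t) + W (x0, t) \<le> U (x0, t0) + W (x0, t0)" by (intro max[OF x0] inner(1))
      then show "along U \<gamma> (1, t) \<le> along U \<gamma> (1, t0) + q * (t - t0) + k * (t - t0)\<^sup>2"
        using low_W[of t] by (simp add: along_def \<gamma>1 q' algebra_simps)
    next
      fix p assume jet: "superjet ({0..1} \<times> UNIV) (\<lambda>z. - along U \<gamma> z) (1, t0) (- p, - q)"
      \<comment> \<open>The maximum of \<open>U + W\<close> dominates the increments of
        \<open>W\<close> by those of \<open>- U\<close>. Hence a subjet of the subsolution becomes
        one of the supersolution on the arc chosen by the vertex condition, first at
        \<open>t0\<close> and then at \<open>\<tau>v\<close>.\<close>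
      have "superjet ((\<lambda>y. y + 0) ` ({0..1} \<times> UNIV)) (along W \<gamma>) ((1, t0) + 0) (- p, - q)"
      proof (rule superjet_transfer[OF jet r(1)])
        fix y :: "real \<times> real" assume y: "y \<in> {0..1} \<times> UNIV" "dist y (1, t0) < r"
        obtain s t where y_eq: "y = (s, t)" by (cases y)
        have "\<bar>t - t0\<bar> \<le> r" using dist_snd_le[of y "(1, t0)"] y(2) by (simp add: y_eq dist_real_def)
        then have "U (\<gamma> s, t) + W (\<gamma> s, t) \<le> U (x0, t0) + W (x0, t0)"
          using y y_eq by (intro max inner(1) arc_continuous(2)[OF E \<gamma>]) auto
        then show "along W \<gamma> (y + 0) - along W \<gamma> ((1, t0) + 0) \<le> - along U \<gamma> y - (- along U \<gamma> (1, t0))"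
          by (simp add: y_eq along_def \<gamma>1)
      qed
      then have "superjet ({0..1} \<times> UNIV) (along W \<gamma>) (1, t0) (- p, - q)" by simp
      then have "superjet ({0..1} \<times> UNIV) (along ?v \<gamma>) (1, \<tau>v) (- p, - q)"
        using \<tau>v(1) by (intro jet_v[OF \<gamma> _ \<tau>_in(2)]) (simp_all add: \<gamma>1)
      then show "0 \<le> q + H \<gamma> 1 p" by (rule vertex)
    qed
  qed
qed

section \<open>Superjets and test functions\<close>

lemma C1_near_paraboloid:
  fixes z g :: "'b::real_inner"
  shows "C1_near z (\<lambda>y. g \<bullet> (y - z) + C * (norm (y - z))\<^sup>2)"
  unfolding C1_near_def
proof (intro exI conjI ballI)
  let ?D = "\<lambda>y. blinfun_inner_right (g + (2 * C) *\<^sub>R (y - z))"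
  show "((\<lambda>y. g \<bullet> (y - z) + C * (norm (y - z))\<^sup>2) has_derivative blinfun_apply (?D y)) (at y)" for y
    unfolding power2_norm_eq_inner
    by (rule derivative_eq_intros refl)+
      (auto simp: fun_eq_iff inner_commute inner_add_left inner_diff_left algebra_simps)
  show "continuous_on UNIV ?D"
    by (intro bounded_linear.continuous_on[OF bounded_linear_blinfun_inner_right] continuous_intros)
qed auto

lemma deriv_paraboloid:
  fixes t0 q C :: real
  shows "deriv (\<lambda>t. q \<bullet> (t - t0) + C * (norm (t - t0))\<^sup>2) t0 = q"
  by (rule DERIV_imp_deriv) (auto intro!: derivative_eq_intros)

lemma deriv_paraboloid_pair:
  fixes s0 t0 p q C :: real
  defines "\<phi> \<equiv> \<lambda>y. (p, q) \<bullet> (y - (s0, t0)) + C * (norm (y - (s0, t0)))\<^sup>2"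
  shows "deriv_s \<phi> s0 t0 = p" and "deriv_t \<phi> s0 t0 = q"
proof -
  have "((\<lambda>s. \<phi> (s, t0)) has_field_derivative p) (at s0)" "((\<lambda>t. \<phi> (s0, t)) has_field_derivative q) (at t0)"
    unfolding \<phi>_def by (auto simp: norm_Pair_power2 intro!: derivative_eq_intros)
  then show "deriv_s \<phi> s0 t0 = p" "deriv_t \<phi> s0 t0 = q" by (auto intro: DERIV_imp_deriv)
qed

lemma superjet_eventually:
  assumes "superjet S w z g"
  obtains C where "\<forall>\<^sub>F y in at z within S. w y - (g \<bullet> (y - z) + C * (norm (y - z))\<^sup>2) \<le> w z"
proof -
  obtain C r where "r > 0" and "\<And>y. y \<in> S \<Longrightarrow> dist y z < r \<Longrightarrow> w y \<le> w z + g \<bullet> (y - z) + C * (norm (y - z))\<^sup>2"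
    using assms unfolding superjet_def by blast
  then show thesis by (intro that[of C]) (force simp: eventually_at)
qed

lemma superjet_supertangent:
  assumes "superjet UNIV w z g"
  obtains C where "supertangent w z (\<lambda>y. g \<bullet> (y - z) + C * (norm (y - z))\<^sup>2)"
proof -
  obtain C where "\<forall>\<^sub>F y in at z. w y - (g \<bullet> (y - z) + C * (norm (y - z))\<^sup>2) \<le> w z"
    by (rule superjet_eventually[OF assms])
  then show thesis using that[of C] C1_near_paraboloid[of z g C] by (simp add: supertangent_def)
qed

lemma subjet_constrained_subtangent:
  assumes "superjet S (\<lambda>y. - w y) z (- g)"
  obtains C where "constrained_subtangent S w z (\<lambda>y. g \<bullet> (y - z) + C * (norm (y - z))\<^sup>2)"
proof -
  obtain C where C: "\<forall>\<^sub>F y in at z within S. - w y - (- g \<bullet> (y - z) + C * (norm (y - z))\<^sup>2) \<le> - w z"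
    by (rule superjet_eventually[OF assms])
  have "\<forall>\<^sub>F y in at z within S. w z \<le> w y - (g \<bullet> (y - z) + - C * (norm (y - z))\<^sup>2)"
    by (rule eventually_mono[OF C]) (simp add: inner_minus_left)
  then show thesis using that[of "- C"] C1_near_paraboloid[of z g "- C"] by (simp add: constrained_subtangent_def)
qed

section \<open>The viscosity and vertex conditions tested on superjets\<close>

lemma viscosity_subsolution_superjet:
  assumes "viscosity_subsolution h T0 T1 w" and "s \<in> {0<..<1}" and "t \<in> time_open T0 T1"
    and "superjet UNIV w (s, t) (p, q)"
  shows "q + h s p \<le> 0"
proof -
  obtain C where "supertangent w (s, t) (\<lambda>y. (p, q) \<bullet> (y - (s, t)) + C * (norm (y - (s, t)))\<^sup>2)"
    by (rule superjet_supertangent[OF assms(4)])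
  from assms(1)[unfolded viscosity_subsolution_def, rule_format, OF assms(2,3) this]
  show ?thesis by (simp only: deriv_paraboloid_pair)
qed

lemma viscosity_supersolution_subjet:
  assumes "viscosity_supersolution h T0 T1 w" and "s \<in> {0<..<1}" and "t \<in> time_open T0 T1"
    and "superjet UNIV (\<lambda>z. - w z) (s, t) (- p, - q)"
  shows "0 \<le> q + h s p"
proof -
  have "superjet UNIV (\<lambda>z. - w z) (s, t) (- (p, q))" using assms(4) by simp
  then obtain C where "constrained_subtangent UNIV w (s, t) (\<lambda>y. (p, q) \<bullet> (y - (s, t)) + C * (norm (y - (s, t)))\<^sup>2)"
    by (rule subjet_constrained_subtangent)
  then have "subtangent w (s, t) (\<lambda>y. (p, q) \<bullet> (y - (s, t)) + C * (norm (y - (s, t)))\<^sup>2)"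
    by (simp add: subtangent_def constrained_subtangent_def)
  from assms(1)[unfolded viscosity_supersolution_def, rule_format, OF assms(2,3) this]
  show ?thesis by (simp only: deriv_paraboloid_pair)
qed

lemma HJ_subsolution_vertex_superjet:
  assumes "HJ_subsolution E H c T0 T1 u" and "x \<in> network_vertices E" and "t \<in> time_open T0 T1"
    and "superjet UNIV (\<lambda>t. u (x, t)) t q"
  shows "q \<le> c x"
proof -
  obtain C where "supertangent (\<lambda>t. u (x, t)) t (\<lambda>y. q \<bullet> (y - t) + C * (norm (y - t))\<^sup>2)"
    by (rule superjet_supertangent[OF assms(4)])
  then have "deriv (\<lambda>y. q \<bullet> (y - t) + C * (norm (y - t))\<^sup>2) t \<le> c x"
    using assms(1-3) unfolding HJ_subsolution_def by blast
  then show ?thesis by (simp only: deriv_paraboloid)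
qed

lemma HJ_supersolution_vertex_subjet:
  assumes "HJ_supersolution E H c T0 T1 v" and "x \<in> network_vertices E" and "t \<in> time_open T0 T1"
    and "superjet UNIV (\<lambda>t. - v (x, t)) t (- q)" and "q < c x"
  obtains \<gamma> where "\<gamma> \<in> arcs_into E x"
    and "\<And>p q. superjet ({0..1} \<times> UNIV) (\<lambda>z. - along v \<gamma> z) (1, t) (- p, - q) \<Longrightarrow> 0 \<le> q + H \<gamma> 1 p"
proof -
  let ?S = "{0..1} \<times> closure (time_open T0 T1)"
  obtain C where "constrained_subtangent UNIV (\<lambda>t. v (x, t)) t (\<lambda>y. q \<bullet> (y - t) + C * (norm (y - t))\<^sup>2)"
    by (rule subjet_constrained_subtangent[OF assms(4)])
  then have "subtangent (\<lambda>t. v (x, t)) t (\<lambda>y. q \<bullet> (y - t) + C * (norm (y - t))\<^sup>2)"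
    by (simp add: subtangent_def constrained_subtangent_def)
  moreover have "deriv (\<lambda>y. q \<bullet> (y - t) + C * (norm (y - t))\<^sup>2) t < c x"
    using assms(5) by (simp only: deriv_paraboloid)
  ultimately obtain \<gamma> where \<gamma>: "\<gamma> \<in> arcs_into E x" and super: "\<And>\<phi>. constrained_subtangent ?S (along v \<gamma>) (1, t) \<phi> \<Longrightarrow>
      deriv_t \<phi> 1 t + H \<gamma> 1 (deriv_s \<phi> 1 t) \<ge> 0"
    using assms(1-3) unfolding HJ_supersolution_def by blast
  show thesis
  proof (rule that[OF \<gamma>])
    fix p q assume "superjet ({0..1} \<times> UNIV) (\<lambda>z. - along v \<gamma> z) (1, t) (- p, - q)"
    then have "superjet ({0..1} \<times> closure (time_open T0 T1)) (\<lambda>z. - along v \<gamma> z) (1, t) (- (p, q))"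
      by (auto elim!: superjet_subset)
    then obtain C where "constrained_subtangent ?S (along v \<gamma>) (1, t) (\<lambda>y. (p, q) \<bullet> (y - (1, t)) + C * (norm (y - (1, t)))\<^sup>2)"
      by (rule subjet_constrained_subtangent)
    from super[OF this] show "0 \<le> q + H \<gamma> 1 p" by (simp only: deriv_paraboloid_pair)
  qed
qed

section \<open>Comparison\<close>

lemma along_uminus: "along (\<lambda>z. - v z) \<gamma> = (\<lambda>z. - along v \<gamma> z)"
  by (auto simp: along_def)

theorem theorem7p7:
  fixes E :: "(real \<Rightarrow> 'a::euclidean_space) set"
    and H :: "(real \<Rightarrow> 'a) \<Rightarrow> real \<Rightarrow> real \<Rightarrow> real"
    and c :: "'a \<Rightarrow> real"
    and T0 :: real and T1 :: ereal
    and u v :: "'a \<times> real \<Rightarrow> real"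
  assumes "0 \<le> T0" and "ereal T0 < T1"
    and "network E"
    and "network_hamiltonians E H"
    and "flux_limiter E H c"
    and "continuous_on (network_points E \<times> time_halfopen T0 T1) u"
    and "continuous_on (network_points E \<times> time_halfopen T0 T1) v"
    and "HJ_subsolution E H c T0 T1 u"
    and "HJ_solution E H c T0 T1 v"
    and "\<forall>x\<in>network_points E. u (x, T0) \<le> v (x, T0)"
  shows "\<forall>x\<in>network_points E. \<forall>t\<in>time_halfopen T0 T1. u (x, t) \<le> v (x, t)"
proof (intro ballI, rule ccontr)
  let ?X = "network_points E"
  fix x t assume x: "x \<in> ?X" and t: "t \<in> time_halfopen T0 T1" and "\<not> u (x, t) \<le> v (x, t)"
  define m where "m = u (x, t) - v (x, t)"
  have m: "m > 0" using \<open>\<not> u (x, t) \<le> v (x, t)\<close> by (simp add: m_def)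
  have "t \<noteq> T0" using assms(10) x m by (auto simp: m_def)
  then have t_gt: "T0 < t" and t_lt: "ereal t < T1" using t by (auto simp: time_halfopen_def)
  \<comment> \<open>An intermediate final time makes the interval compact and leaves room after
    \<open>t\<close> in which the subtracted function can become large.\<close>
  obtain T where T: "t < T" "ereal T < T1" using ereal_dense2[OF t_lt] by auto
  have times: "{T0..T} \<subseteq> time_halfopen T0 T1" "{T0<..<T} \<subseteq> time_open T0 T1"
    using T(2) by (auto simp: time_halfopen_def time_open_def intro: le_less_trans[OF _ T(2)] less_trans[OF _ T(2)])
  have K: "compact (?X \<times> {T0..T})" by (intro compact_Times compact_network_points assms(3) compact_Icc)
  have u_cont: "continuous_on (?X \<times> {T0..T}) u" and v_cont: "continuous_on (?X \<times> {T0..T}) v"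
    using times by (auto intro!: continuous_on_subset[OF assms(6)] continuous_on_subset[OF assms(7)])
  obtain M where M: "\<And>z. z \<in> ?X \<times> {T0..T} \<Longrightarrow> \<bar>u z - v z\<bar> \<le> M"
    using bounded_on_compact[OF K continuous_on_diff[OF u_cont v_cont]] by blast
  have "M \<ge> 0" using M[of "(x, t)"] x t_gt T by auto
  define \<alpha> where "\<alpha> = m / 2 / (t - T0 + 1)"
  define A where "A = M / (T - t)\<^sup>2"
  have \<alpha>: "\<alpha> > 0" using m t_gt by (simp add: \<alpha>_def)
  have ne: "t - T0 + 1 \<noteq> 0" using t_gt by simp
  have \<alpha>_t: "\<alpha> * (t - T0 + 1) = m / 2" by (rule nonzero_eq_divide_eq[OF ne, THEN iffD1, OF \<alpha>_def])
  have A: "A \<ge> 0" "A * (T - t)\<^sup>2 = M" using \<open>M \<ge> 0\<close> T by (auto simp: A_def)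
  \<comment> \<open>The linear part has slope \<open>\<alpha>\<close>, the margin of strictness, and
    the summand \<open>1\<close> makes it positive already at \<open>T0\<close>. It amounts to only
    \<open>m / 2\<close> at \<open>t\<close>, so the assumed violation survives there. The quadratic
    part starts after \<open>t\<close> and reaches \<open>M\<close> at \<open>T\<close>, which
    pushes \<open>w\<close> below \<open>v\<close> at the final time without spoiling the slope
    bound.\<close>
  define f where "f \<tau> = \<alpha> * (\<tau> - T0 + 1) + A * (max 0 (\<tau> - t))\<^sup>2" for \<tau>
  define f' where "f' \<tau> = \<alpha> + 2 * A * max 0 (\<tau> - t)" for \<tau>
  have f_le: "f \<sigma> \<le> f \<tau> + f' \<tau> * (\<sigma> - \<tau>) + A * (\<sigma> - \<tau>)\<^sup>2" for \<sigma> \<tau>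
    using mult_left_mono[OF max_0_square_le[of "\<sigma> - t" "\<tau> - t"] A(1)]
    by (simp add: f_def f'_def algebra_simps)
  have f'_ge: "\<alpha> \<le> f' \<tau>" for \<tau> using A by (simp add: f'_def)
  have f_cont: "continuous_on S (\<lambda>z. f (snd z))" for S :: "('a \<times> real) set"
    unfolding f_def by (intro continuous_intros)
  define w where "w = (\<lambda>z. u z - f (snd z))"
  have sub: "\<And>\<gamma>. \<gamma> \<in> E \<Longrightarrow> viscosity_subsolution (H \<gamma>) T0 T1 (along u \<gamma>)"
    using assms(8) unfolding HJ_subsolution_def by blast
  have super: "HJ_supersolution E H c T0 T1 v" using assms(9) unfolding HJ_solution_def by blast
  have "w (x, t) \<le> v (x, t)"
  proof (rule strict_comparison[OF assms(3,4) _ \<alpha> _ v_cont, where c = c])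
    show "T0 < T" using t_gt T by simp
    show "continuous_on (?X \<times> {T0..T}) w"
      unfolding w_def by (intro continuous_intros u_cont f_cont)
    show "x \<in> ?X" by (rule x)
    show "t \<in> {T0..T}" using t_gt T by simp
  next
    fix \<gamma> s \<tau> p q
    assume \<gamma>: "\<gamma> \<in> E" and s: "s \<in> {0<..<1}" and \<tau>: "\<tau> \<in> {T0<..<T}"
      and jet: "superjet UNIV (along w \<gamma>) (s, \<tau>) (p, q)"
    have "superjet UNIV (\<lambda>y. along w \<gamma> y + f (snd y)) (s, \<tau>) ((p, q) + (0, f' \<tau>))"
    proof (rule superjet_add[OF jet, where C' = A])
      fix y :: "real \<times> real"
      obtain s' \<sigma> where y: "y = (s', \<sigma>)" by (cases y)
      have "A * (\<sigma> - \<tau>)\<^sup>2 \<le> A * ((s' - s)\<^sup>2 + (\<sigma> - \<tau>)\<^sup>2)" using A by (intro mult_left_mono) auto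
      then show "f (snd y) \<le> f (snd (s, \<tau>)) + (0, f' \<tau>) \<bullet> (y - (s, \<tau>)) + A * (norm (y - (s, \<tau>)))\<^sup>2"
        using f_le[of \<sigma> \<tau>] by (simp add: y norm_Pair_power2)
    qed
    moreover have "(\<lambda>y. along w \<gamma> y + f (snd y)) = along u \<gamma>" by (auto simp: along_def w_def)
    ultimately have "superjet UNIV (along u \<gamma>) (s, \<tau>) (p, q + f' \<tau>)" by simp
    then have "q + f' \<tau> + H \<gamma> s p \<le> 0"
      using viscosity_subsolution_superjet[OF sub[OF \<gamma>] s] \<tau> times(2) by blast
    then show "q + H \<gamma> s p \<le> - \<alpha>" using f'_ge[of \<tau>] by linarith
  next
    fix x \<tau> q
    assume x: "x \<in> network_vertices E" and \<tau>: "\<tau> \<in> {T0<..<T}" and jet: "superjet UNIV (\<lambda>t. w (x, t)) \<tau> q"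
    have "superjet UNIV (\<lambda>t. w (x, t) + f t) \<tau> (q + f' \<tau>)"
      by (rule superjet_add[OF jet, where C' = A]) (use f_le in simp)
    then have "superjet UNIV (\<lambda>t. u (x, t)) \<tau> (q + f' \<tau>)" by (simp add: w_def)
    then have "q + f' \<tau> \<le> c x"
      using HJ_subsolution_vertex_superjet[OF assms(8) x] \<tau> times(2) by blast
    then show "q \<le> c x - \<alpha>" using f'_ge[of \<tau>] by linarith
  next
    fix \<gamma> s \<tau> p q
    assume \<gamma>: "\<gamma> \<in> E" and s: "s \<in> {0<..<1}" and \<tau>: "\<tau> \<in> {T0<..<T}"
      and jet: "superjet UNIV (along (\<lambda>z. - v z) \<gamma>) (s, \<tau>) (- p, - q)"
    have "viscosity_supersolution (H \<gamma>) T0 T1 (along v \<gamma>)"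
      using super \<gamma> unfolding HJ_supersolution_def by blast
    moreover have "superjet UNIV (\<lambda>z. - along v \<gamma> z) (s, \<tau>) (- p, - q)"
      using jet by (simp add: along_uminus)
    ultimately show "0 \<le> q + H \<gamma> s p"
      using viscosity_supersolution_subjet[OF _ s] \<tau> times(2) by blast
  next
    fix x \<tau> q
    assume x: "x \<in> network_vertices E" and \<tau>: "\<tau> \<in> {T0<..<T}"
      and jet: "superjet UNIV (\<lambda>t. - v (x, t)) \<tau> (- q)" and q: "q < c x"
    have \<tau>': "\<tau> \<in> time_open T0 T1" using \<tau> times(2) by blast
    obtain \<gamma> where "\<gamma> \<in> arcs_into E x"
      and "\<And>p q. superjet ({0..1} \<times> UNIV) (\<lambda>z. - along v \<gamma> z) (1, \<tau>) (- p, - q) \<Longrightarrow> 0 \<le> q + H \<gamma> 1 p"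
      by (rule HJ_supersolution_vertex_subjet[OF super x \<tau>' jet q]) (rule that)
    then show "\<exists>\<gamma>\<in>arcs_into E x. \<forall>p q.
        superjet ({0..1} \<times> UNIV) (along (\<lambda>z. - v z) \<gamma>) (1, \<tau>) (- p, - q) \<longrightarrow> 0 \<le> q + H \<gamma> 1 p"
      by (auto simp: along_uminus)
  next
    fix x assume x: "x \<in> ?X"
    have "u (x, T0) \<le> v (x, T0)" using assms(10) x by blast
    moreover have "f T0 = \<alpha>" using t_gt by (simp add: f_def)
    ultimately show "w (x, T0) < v (x, T0)" using \<alpha> by (simp add: w_def)
    have "M + \<alpha> * (T - T0 + 1) = f T" using T A by (simp add: f_def)
    moreover have "\<alpha> * (T - T0 + 1) > 0" using \<alpha> t_gt T by simp
    moreover have "u (x, T) - v (x, T) \<le> M" using M[of "(x, T)"] x t_gt T by auto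
    ultimately show "w (x, T) < v (x, T)" by (simp add: w_def)
  qed
  then have "u (x, t) - f t \<le> v (x, t)" by (simp add: w_def)
  moreover have "2 * f t = m" using \<alpha>_t by (simp add: f_def)
  ultimately show False using m m_def by linarith
qed

end
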